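(* Let $\Omega\subset\mathbb{R}^2$ be a bounded convex polygonal domain, $T>0$, $\mu>0$, $N$ a positive integer and $\tau=T/N$. Let $(\sigma_h^n,\mathbf{u}_h^n,p_h^n)\in M_h^2\times\mathbf{X}_h^2\times\mathring M_h^1$, $0\le n\le N$, with $\rho_h^n=(\sigma_h^n)^2$, be such that for every $n=1,\dots,N-1$ and all $(\varphi_h,\mathbf{v}_h,q_h)\in M_h^2\times\mathbf{X}_h^2\times\mathring M_h^1$, $$(D_\tau\sigma_h^{n+1},\varphi_h)+(\nabla\sigma_h^{n+1}\cdot\hat{\mathbf{u}}_h^{n+1},\varphi_h)+\tfrac12(\nabla\cdot\hat{\mathbf{u}}_h^{n+1}\,\sigma_h^{n+1},\varphi_h)=0,$$ $$(\sigma_h^{n+1}D_\tau(\sigma_h^{n+1}\mathbf{u}_h^{n+1}),\mathbf{v}_h)+(\rho_h^{n+1}\hat{\mathbf{u}}_h^{n+1}\cdot\nabla\mathbf{u}_h^{n+1},\mathbf{v}_h)+\tfrac12(\mathbf{u}_h^{n+1}\nabla\cdot(\rho_h^{n+1}\hat{\mathbf{u}}_h^{n+1}),\mathbf{v}_h)+B((\mathbf{u}_h^{n+1},p_h^{n+1}),(\mathbf{v}_h,q_h))=0.$$ For $n=1,\dots,N$ define the discrete energy $$E^n=\|\sigma_h^n\|_{L^2}^2+\|\sigma_h^n\mathbf{u}_h^n\|_{L^2}^2+\|2\sigma_h^n-\sigma_h^{n-1}\|_{L^2}^2+\|2\sigma_h^n\mathbf{u}_h^n-\sigma_h^{n-1}\mathbf{u}_h^{n-1}\|_{L^2}^2.$$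 Then $$E^{n+1}\le E^n,\qquad n=1,2,\dots,N-1.$$
   Context: $(\cdot,\cdot)$ is the $L^2(\Omega)$ inner product for scalar or vector functions. For a sequence $\{z^n\}_{n=0}^N$ and $1\le n\le N-1$, $$\hat z^{n+1}=2z^n-z^{n-1},\qquad D_\tau z^{n+1}=\frac{3z^{n+1}-4z^n+z^{n-1}}{2\tau};$$ $D_\tau(\sigma_h^{n+1}\mathbf{u}_h^{n+1})$ is $D_\tau$ applied to the sequence $\sigma_h^n\mathbf{u}_h^n$. $\mathscr{T}_h$ is a quasi-uniform triangulation of $\Omega$ into triangles $\mathcal{T}_j$, $j=1,\dots,M$, with mesh size $h=\max_j\mathrm{diam}(\mathcal{T}_j)$; $P_r(\mathcal{T}_j)$ is the space of polynomials of degree $\le r$ on $\mathcal{T}_j$. Define $$M_h^r=\{w_h\in H^1(\Omega): w_h|_{\mathcal{T}_j}\in P_r(\mathcal{T}_j)\ \forall j\},\qquad \mathbf{X}_h^2=\{\mathbf{w}_h\in H_0^1(\Omega)^2:\mathbf{w}_h|_{\mathcal{T}_j}\in P_2(\mathcal{T}_j)^2\ \forall j\},\qquad \mathring M_h^1=\{q_h\in M_h^1:\textstyle\int_\Omega q_h\,dx=0\}.$$ The bilinear form is $B((\mathbf{u},p),(\mathbf{v},q))=(\mu\nabla\mathbf{u},\nabla\mathbf{v})-(p,\nabla\cdot\mathbf{v})+(\nabla\cdot\mathbf{u},q)$. The two displayed equations in the claim are the BDF2 finite element scheme for the variable-density incompressible Navier--Stokes equations (velocity $\mathbf{u}$, pressure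 $p$, density $\rho=\sigma^2$, viscosity $\mu$); the values with indices $0$ and $1$ are given starting values. *)

theory Defs
  imports "HOL-Analysis.Analysis"
begin

section \<open>Square integrable functions\<close>

text \<open>
  Elements of \<open>L\<^sup>2\<close> and of the Sobolev spaces are represented by functions on the whole plane; only
  their values almost everywhere on \<open>\<Omega>\<close> matter.
\<close>

definition L2_inner :: "(real^2) set \<Rightarrow> (real^2 \<Rightarrow> 'b::real_inner) \<Rightarrow> (real^2 \<Rightarrow> 'b) \<Rightarrow> real" where
  "L2_inner \<Omega> f g = integral\<^sup>L (lebesgue_on \<Omega>) (\<lambda>x. f x \<bullet> g x)"

definition L2_norm :: "(real^2) set \<Rightarrow> (real^2 \<Rightarrow> 'b::real_inner) \<Rightarrow> real" where
  "L2_norm \<Omega> f = sqrt (L2_inner \<Omega> f f)"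

definition L2_space :: "(real^2) set \<Rightarrow> (real^2 \<Rightarrow> real) set" where
  "L2_space \<Omega> = {f. f \<in> borel_measurable (lebesgue_on \<Omega>) \<and>
                     integrable (lebesgue_on \<Omega>) (\<lambda>x. (f x)\<^sup>2)}"


section \<open>Test functions and weak derivatives\<close>

definition pdiff :: "2 \<Rightarrow> (real^2 \<Rightarrow> real) \<Rightarrow> real^2 \<Rightarrow> real" where
  "pdiff i f x = frechet_derivative f (at x) (axis i 1)"

text \<open>\<open>diff_times k f\<close>: all partial derivatives of order less than \<open>k\<close> are (totally) differentiable
  everywhere.\<close>

fun diff_times :: "nat \<Rightarrow> (real^2 \<Rightarrow> real) \<Rightarrow> bool" where
  "diff_times 0 f \<longleftrightarrow> True"
| "diff_times (Suc k) f \<longleftrightarrow> (\<forall>x. f differentiable (at x)) \<and> (\<forall>i. diff_times k (pdiff i f))"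

definition test_functions :: "(real^2) set \<Rightarrow> (real^2 \<Rightarrow> real) set" where
  "test_functions \<Omega> = {\<phi>. (\<forall>k. diff_times k \<phi>) \<and>
      compact (closure {x. \<phi> x \<noteq> 0}) \<and> closure {x. \<phi> x \<noteq> 0} \<subseteq> \<Omega>}"

definition locally_integrable :: "(real^2) set \<Rightarrow> (real^2 \<Rightarrow> real) \<Rightarrow> bool" where
  "locally_integrable \<Omega> f \<longleftrightarrow> (\<forall>K. compact K \<and> K \<subseteq> \<Omega> \<longrightarrow> integrable (lebesgue_on K) f)"

definition is_weak_pdiff :: "(real^2) set \<Rightarrow> 2 \<Rightarrow> (real^2 \<Rightarrow> real) \<Rightarrow> (real^2 \<Rightarrow> real) \<Rightarrow> bool" where
  "is_weak_pdiff \<Omega> i f g \<longleftrightarrow> locally_integrable \<Omega> f \<and> locally_integrable \<Omega> g \<and>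
     (\<forall>\<phi>\<in>test_functions \<Omega>. L2_inner \<Omega> f (pdiff i \<phi>) = - L2_inner \<Omega> g \<phi>)"

text \<open>A weak derivative is unique up to a null set, so integrals do not depend on the choice made
  here. For functions without a weak derivative the value is meaningless.\<close>

definition weak_pdiff :: "(real^2) set \<Rightarrow> 2 \<Rightarrow> (real^2 \<Rightarrow> real) \<Rightarrow> real^2 \<Rightarrow> real" where
  "weak_pdiff \<Omega> i f = (SOME g. is_weak_pdiff \<Omega> i f g)"

definition weak_grad :: "(real^2) set \<Rightarrow> (real^2 \<Rightarrow> real) \<Rightarrow> real^2 \<Rightarrow> real^2" where
  "weak_grad \<Omega> f x = (\<chi> i. weak_pdiff \<Omega> i f x)"

text \<open>The gradient of a vector field is its Jacobian matrix: row \<open>i\<close> is the gradient of component \<open>i\<close>.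
  Hence \<open>\<bullet>\<close> on such matrices is the Frobenius product, and \<open>w \<cdot> \<nabla>v\<close> is the matrix-vector product of the
  Jacobian of \<open>v\<close> with \<open>w\<close>.\<close>

definition weak_jac :: "(real^2) set \<Rightarrow> (real^2 \<Rightarrow> real^2) \<Rightarrow> real^2 \<Rightarrow> real^2^2" where
  "weak_jac \<Omega> v x = (\<chi> i. weak_grad \<Omega> (\<lambda>y. v y $ i) x)"

definition weak_div :: "(real^2) set \<Rightarrow> (real^2 \<Rightarrow> real^2) \<Rightarrow> real^2 \<Rightarrow> real" where
  "weak_div \<Omega> v x = (\<Sum>i\<in>UNIV. weak_pdiff \<Omega> i (\<lambda>y. v y $ i) x)"


section \<open>Sobolev spaces\<close>

definition H1 :: "(real^2) set \<Rightarrow> (real^2 \<Rightarrow> real) set" where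
  "H1 \<Omega> = {f \<in> L2_space \<Omega>. \<forall>i. \<exists>g\<in>L2_space \<Omega>. is_weak_pdiff \<Omega> i f g}"

text \<open>The closure of the test functions in the \<open>H\<^sup>1\<close> norm.\<close>

definition H10 :: "(real^2) set \<Rightarrow> (real^2 \<Rightarrow> real) set" where
  "H10 \<Omega> = {f \<in> H1 \<Omega>. \<exists>\<phi>. (\<forall>k::nat. \<phi> k \<in> test_functions \<Omega>) \<and>
      (\<lambda>k. L2_norm \<Omega> (\<lambda>x. \<phi> k x - f x)) \<longlonglongrightarrow> 0 \<and>
      (\<forall>i. (\<lambda>k. L2_norm \<Omega> (\<lambda>x. pdiff i (\<phi> k) x - weak_pdiff \<Omega> i f x)) \<longlonglongrightarrow> 0)}"


section \<open>Domain and mesh\<close>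

definition convex_polygonal_domain :: "(real^2) set \<Rightarrow> bool" where
  "convex_polygonal_domain \<Omega> \<longleftrightarrow>
     open \<Omega> \<and> \<Omega> \<noteq> {} \<and> bounded \<Omega> \<and> convex \<Omega> \<and> polytope (closure \<Omega>)"

definition triangle_mesh :: "(real^2) set \<Rightarrow> (real^2) set set \<Rightarrow> bool" where
  "triangle_mesh \<Omega> \<T> \<longleftrightarrow> triangulation \<T> \<and> (\<forall>T\<in>\<T>. 2 simplex T) \<and> \<Union>\<T> = closure \<Omega>"

definition mesh_size :: "(real^2) set set \<Rightarrow> real" where
  "mesh_size \<T> = Max (diameter ` \<T>)"

text \<open>Quasi-uniformity with constant \<open>\<kappa>\<close>: every triangle contains a disc of radius \<open>\<kappa> h\<close>. A family of
  meshes is quasi-uniform iff one \<open>\<kappa> > 0\<close> serves all its members.\<close>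

definition quasi_uniform :: "real \<Rightarrow> (real^2) set set \<Rightarrow> bool" where
  "quasi_uniform \<kappa> \<T> \<longleftrightarrow> (\<forall>T\<in>\<T>. \<exists>x. cball x (\<kappa> * mesh_size \<T>) \<subseteq> T)"


section \<open>Finite element spaces\<close>

definition poly2_fun :: "nat \<Rightarrow> (real^2 \<Rightarrow> real) \<Rightarrow> bool" where
  "poly2_fun r p \<longleftrightarrow>
     (\<exists>c :: nat \<Rightarrow> nat \<Rightarrow> real. \<forall>x. p x = (\<Sum>i\<le>r. \<Sum>j\<le>r - i. c i j * (x$1) ^ i * (x$2) ^ j))"

definition piecewise_poly :: "(real^2) set set \<Rightarrow> nat \<Rightarrow> (real^2 \<Rightarrow> real) \<Rightarrow> bool" where
  "piecewise_poly \<T> r w \<longleftrightarrow> (\<forall>T\<in>\<T>. \<exists>p. poly2_fun r p \<and> (AE x in lebesgue_on T. w x = p x))"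

definition FE_M :: "(real^2) set \<Rightarrow> (real^2) set set \<Rightarrow> nat \<Rightarrow> (real^2 \<Rightarrow> real) set" where
  "FE_M \<Omega> \<T> r = {w \<in> H1 \<Omega>. piecewise_poly \<T> r w}"

definition FE_X :: "(real^2) set \<Rightarrow> (real^2) set set \<Rightarrow> nat \<Rightarrow> (real^2 \<Rightarrow> real^2) set" where
  "FE_X \<Omega> \<T> r = {w. \<forall>i. (\<lambda>x. w x $ i) \<in> H10 \<Omega> \<and> piecewise_poly \<T> r (\<lambda>x. w x $ i)}"

definition FE_M0 :: "(real^2) set \<Rightarrow> (real^2) set set \<Rightarrow> nat \<Rightarrow> (real^2 \<Rightarrow> real) set" where
  "FE_M0 \<Omega> \<T> r = {q \<in> FE_M \<Omega> \<T> r. integral\<^sup>L (lebesgue_on \<Omega>) q = 0}"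


section \<open>The scheme\<close>

text \<open>The index \<open>m\<close> is that of the new time level (\<open>n + 1\<close> in the usual notation), so both definitions
  are meant for \<open>m \<ge> 2\<close>.\<close>

definition extrap :: "(nat \<Rightarrow> real^2 \<Rightarrow> 'b::real_vector) \<Rightarrow> nat \<Rightarrow> real^2 \<Rightarrow> 'b" where
  "extrap z m x = 2 *\<^sub>R z (m - 1) x - z (m - 2) x"

definition D_tau :: "real \<Rightarrow> (nat \<Rightarrow> real^2 \<Rightarrow> 'b::real_vector) \<Rightarrow> nat \<Rightarrow> real^2 \<Rightarrow> 'b" where
  "D_tau \<tau> z m x = (3 *\<^sub>R z m x - 4 *\<^sub>R z (m - 1) x + z (m - 2) x) /\<^sub>R (2 * \<tau>)"

definition B_form :: "(real^2) set \<Rightarrow> real \<Rightarrow>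
    (real^2 \<Rightarrow> real^2) \<times> (real^2 \<Rightarrow> real) \<Rightarrow> (real^2 \<Rightarrow> real^2) \<times> (real^2 \<Rightarrow> real) \<Rightarrow> real" where
  "B_form \<Omega> \<mu> = (\<lambda>(u, p) (v, q).
     L2_inner \<Omega> (\<lambda>x. \<mu> *\<^sub>R weak_jac \<Omega> u x) (weak_jac \<Omega> v)
     - L2_inner \<Omega> p (weak_div \<Omega> v) + L2_inner \<Omega> (weak_div \<Omega> u) q)"

definition energy :: "(real^2) set \<Rightarrow> (nat \<Rightarrow> real^2 \<Rightarrow> real) \<Rightarrow> (nat \<Rightarrow> real^2 \<Rightarrow> real^2) \<Rightarrow> nat \<Rightarrow> real" where
  "energy \<Omega> \<sigma> u n =
     (L2_norm \<Omega> (\<sigma> n))\<^sup>2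
     + (L2_norm \<Omega> (\<lambda>x. \<sigma> n x *\<^sub>R u n x))\<^sup>2
     + (L2_norm \<Omega> (\<lambda>x. 2 * \<sigma> n x - \<sigma> (n - 1) x))\<^sup>2
     + (L2_norm \<Omega> (\<lambda>x. 2 *\<^sub>R (\<sigma> n x *\<^sub>R u n x) - \<sigma> (n - 1) x *\<^sub>R u (n - 1) x))\<^sup>2"

end

theory Submission
  imports Defs
begin

text \<open>
  The energy decays because the scheme, tested with its own solution, leaves only terms of known sign.
  Write \<open>w\<close> for the extrapolated velocity. With \<open>\<phi> = \<sigma>\<close> the convection terms of the density equation
  add up to half the integral of \<open>\<nabla> \<cdot> (\<sigma>\<^sup>2 w)\<close>, and with \<open>v = u\<close> those of the momentum equation to half
  the integral of \<open>\<nabla> \<cdot> (\<sigma>\<^sup>2 \<bar>u\<bar>\<^sup>2 w)\<close>; both vanish since \<open>w\<close> is zero on the boundary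
  (\<open>density_convection_skew\<close>, \<open>momentum_convection_skew\<close>). The pressure terms cancel for \<open>q = p\<close> and the
  viscous term is nonnegative. So the backward differences, tested with \<open>\<sigma>\<close> and with \<open>\<sigma> u\<close>, have a sum
  of integrals that is at most zero, and \<open>bdf2_identity\<close> writes \<open>4\<tau>\<close> times this sum as the increment of
  the energy plus a nonnegative remainder.

  The analytic work lies in the two divergence identities, because the derivatives are weak ones,
  chosen arbitrarily in their equivalence class, and a product rule is needed for polynomials in finite
  element functions. The route is by difference quotients. Weak derivatives are unique almost
  everywhere (\<open>weak_pdiff_unique\<close>); for a finite element function they are therefore the piecewise
  derivatives of its polynomials, in particular bounded. A function with bounded weak derivative is
  Lipschitz along lines (\<open>weak_pdiff_bounded_imp_Lipschitz\<close>), so its difference quotients are bounded,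
  and inside the triangles they converge (\<open>FE_M_bounded_pdiff\<close>). Bounded convergent difference quotients
  satisfy a product rule (\<open>bounded_pdiff_mult\<close>) and yield a weak derivative
  (\<open>bounded_pdiff_imp_weak_pdiff\<close>). Approximating \<open>w\<close> by test functions then gives integration by
  parts without boundary term (\<open>H10_zero_boundary\<close>).

  The only test functions constructed are products of smooth functions of one variable. They
  approximate indicator functions of boxes, and integrals over boxes determine a function at its
  Lebesgue points.
\<close>

section \<open>Smooth functions of one variable\<close>
text \<open>
  Differentiability of each finite order is treated separately, so that closure under products is an
  induction on the order: in \<open>f' g + g' f\<close> the derivatives have one order less than \<open>f\<close> and \<open>g\<close>, and
  the induction hypothesis applies once \<open>f\<close> and \<open>g\<close> are also regarded as functions of this lower order.
\<close>
fun smooth :: "nat \<Rightarrow> (real \<Rightarrow> real) \<Rightarrow> bool" where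
  "smooth 0 f \<longleftrightarrow> True"
| "smooth (Suc k) f \<longleftrightarrow> (\<exists>f'. (\<forall>t. (f has_real_derivative f' t) (at t)) \<and> smooth k f')"

lemma smooth_SucI:
  assumes "\<And>t. (f has_real_derivative f' t) (at t)" "smooth k f'"
  shows "smooth (Suc k) f"
  using assms by auto

lemma smooth_Suc_D: "smooth (Suc k) f \<Longrightarrow> smooth k f"
proof (induction k arbitrary: f)
  case (Suc k)
  then obtain f' where f': "\<forall>t. (f has_real_derivative f' t) (at t)" "smooth (Suc k) f'"
    by auto
  with Suc.IH[of f'] show ?case by auto
qed simp

lemma smooth_const: "smooth k (\<lambda>_. c)"
proof (induction k arbitrary: c)
  case (Suc k)
  show ?case
    by (rule smooth_SucI[where f' = "\<lambda>_. 0"]) (use Suc in auto)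
qed simp

lemma smooth_add: "smooth k f \<Longrightarrow> smooth k g \<Longrightarrow> smooth k (\<lambda>t. f t + g t)"
proof (induction k arbitrary: f g)
  case (Suc k)
  then obtain f' g' where
    "\<And>t. (f has_real_derivative f' t) (at t)" "smooth k f'"
    "\<And>t. (g has_real_derivative g' t) (at t)" "smooth k g'" by auto
  with Suc.IH[of f' g'] show ?case
    by (intro smooth_SucI[where f' = "\<lambda>t. f' t + g' t"]) (auto intro: DERIV_add)
qed simp

lemma smooth_mult: "smooth k f \<Longrightarrow> smooth k g \<Longrightarrow> smooth k (\<lambda>t. f t * g t)"
proof (induction k arbitrary: f g)
  case (Suc k)
  then obtain f' g' where *:
    "\<And>t. (f has_real_derivative f' t) (at t)" "smooth k f'"
    "\<And>t. (g has_real_derivative g' t) (at t)" "smooth k g'" by auto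
  have "smooth k f" "smooth k g"
    using Suc.prems smooth_Suc_D by auto
  then show ?case
    by (intro smooth_SucI[where f' = "\<lambda>t. f' t * g t + g' t * f t"] DERIV_mult smooth_add Suc.IH *)
qed simp

lemma smooth_affine: "smooth k f \<Longrightarrow> smooth k (\<lambda>t. f (c * t + d))"
proof (induction k arbitrary: f)
  case (Suc k)
  then obtain f' where f': "\<And>t. (f has_real_derivative f' t) (at t)" "smooth k f'"
    by auto
  have "((\<lambda>t. f (c * t + d)) has_real_derivative f' (c * t + d) * c) (at t)" for t
    by (rule DERIV_chain2[OF f'(1)]) (auto intro!: derivative_eq_intros)
  then show ?case
    by (rule smooth_SucI) (intro smooth_mult smooth_const Suc.IH f')
qed simp

lemma smooth_continuous: "smooth (Suc k) f \<Longrightarrow> isCont f t"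
  by (auto dest: DERIV_isCont)

text \<open>
  The functions \<open>t\<^sup>-\<^sup>j exp(-1/t)\<close> on the positive half line, extended by zero. Differentiation maps
  this family into its own linear span, and all members tend to zero at the origin; this is why
  \<open>exp(-1/t)\<close> is smooth.
\<close>
definition flat_exp :: "nat \<Rightarrow> real \<Rightarrow> real" where
  "flat_exp j t = (if t > 0 then inverse t ^ j * exp (- inverse t) else 0)"

lemma flat_exp_tendsto_0: "(flat_exp j \<longlongrightarrow> 0) (at 0)"
proof -
  have "((\<lambda>t. inverse t ^ j / exp (inverse t)) \<longlongrightarrow> (0::real)) (at_right 0)"
    using filterlim_compose[OF tendsto_power_div_exp_0 filterlim_inverse_at_top_right] .
  then have "(flat_exp j \<longlongrightarrow> 0) (at_right 0)"
    by (rule Lim_transform_eventually)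
      (auto simp: flat_exp_def exp_minus field_simps eventually_at_right_less intro: eventually_mono[OF eventually_at_right_less])
  moreover have "(flat_exp j \<longlongrightarrow> 0) (at_left 0)"
    by (rule Lim_transform_eventually[OF tendsto_const])
      (auto simp: flat_exp_def eventually_at_filter)
  ultimately show ?thesis
    by (simp add: filterlim_at_split)
qed

lemma flat_exp_has_derivative:
  "(flat_exp j has_real_derivative flat_exp (Suc (Suc j)) t - j * flat_exp (Suc j) t) (at t)"
proof -
  consider "t > 0" | "t = 0" | "t < 0" by linarith
  then show ?thesis
  proof cases
    case 1
    have "((\<lambda>t. inverse t ^ j * exp (- inverse t)) has_real_derivative
        inverse t ^ Suc (Suc j) * exp (- inverse t) - j * (inverse t ^ Suc j * exp (- inverse t))) (at t)"
    proof -
      have inv: "(inverse has_real_derivative - (inverse t ^ 2)) (at t)"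
        using DERIV_inverse[of t UNIV] 1 by (simp add: numeral_2_eq_2)
      have ex: "((\<lambda>t. exp (- inverse t)) has_real_derivative exp (- inverse t) * inverse t ^ 2) (at t)"
        using DERIV_chain2[OF DERIV_exp DERIV_minus[OF inv]] by simp
      have pow: "((\<lambda>t. inverse t ^ j) has_real_derivative - (j * inverse t ^ Suc j)) (at t)"
      proof (cases j)
        case (Suc i)
        show ?thesis
          using DERIV_power_Suc[OF inv, of i] unfolding Suc
          by (simp add: power2_eq_square algebra_simps)
      qed simp
      show ?thesis
        using DERIV_mult[OF pow ex] by (simp add: power2_eq_square algebra_simps)
    qed
    moreover have "\<forall>\<^sub>F s in nhds t. inverse s ^ j * exp (- inverse s) = flat_exp j s"
      using eventually_nhds_in_open[of "{0<..}" t] 1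
      by (auto simp: flat_exp_def elim!: eventually_mono)
    ultimately show ?thesis
      using 1 by (subst DERIV_cong_ev[OF refl _ refl, where g = "\<lambda>t. inverse t ^ j * exp (- inverse t)"])
        (auto simp: flat_exp_def elim: eventually_mono)
  next
    case 2
    have "(\<lambda>h. (flat_exp j (0 + h) - flat_exp j 0) / h) = flat_exp (Suc j)"
      by (auto simp: flat_exp_def fun_eq_iff field_simps)
    then have "(flat_exp j has_real_derivative 0) (at 0)"
      unfolding DERIV_def using flat_exp_tendsto_0[of "Suc j"] by simp
    then show ?thesis using 2 by (simp add: flat_exp_def)
  next
    case 3
    have "\<forall>\<^sub>F s in nhds t. flat_exp j s = 0"
      using eventually_nhds_in_open[of "{..<0}" t] 3
      by (auto simp: flat_exp_def elim!: eventually_mono)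
    then have "(flat_exp j has_real_derivative 0) (at t)"
      by (subst DERIV_cong_ev[OF refl _ refl, where g = "\<lambda>_. 0"]) auto
    then show ?thesis using 3 by (simp add: flat_exp_def)
  qed
qed

lemma smooth_flat_exp: "smooth k (flat_exp j)"
proof (induction k arbitrary: j)
  case (Suc k)
  have "smooth k (\<lambda>t. flat_exp (Suc (Suc j)) t + - real j * flat_exp (Suc j) t)"
    by (intro smooth_add smooth_mult smooth_const Suc.IH)
  then show ?case
    by (intro smooth_SucI[where f' = "\<lambda>t. flat_exp (Suc (Suc j)) t - real j * flat_exp (Suc j) t"]
        flat_exp_has_derivative) simp
qed simp

text \<open>
  Converges pointwise to the indicator function of the open interval as \<open>m\<close> grows, because
  \<open>exp(-1/(m t))\<close> tends to \<open>1\<close> for each \<open>t > 0\<close>.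
\<close>
definition bump :: "real \<Rightarrow> real \<Rightarrow> nat \<Rightarrow> real \<Rightarrow> real" where
  "bump a b m t = flat_exp 0 (m * (t - a)) * flat_exp 0 (m * (b - t))"

lemma flat_exp_0_range: "0 \<le> flat_exp 0 t" "flat_exp 0 t \<le> 1"
  by (auto simp: flat_exp_def)

lemma smooth_bump: "smooth k (bump a b m)"
proof -
  have "smooth k (\<lambda>t. flat_exp 0 (m * t + - m * a) * flat_exp 0 (- m * t + m * b))"
    by (rule smooth_mult[OF smooth_affine[OF smooth_flat_exp] smooth_affine[OF smooth_flat_exp]])
  then show ?thesis by (simp add: bump_def[abs_def] algebra_simps)
qed

lemma bump_range: "0 \<le> bump a b m t" "bump a b m t \<le> 1"
  by (auto simp: bump_def flat_exp_0_range intro!: mult_nonneg_nonneg mult_le_one)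

lemma bump_outside: "t \<notin> {a<..<b} \<Longrightarrow> bump a b m t = 0"
  by (auto simp: bump_def flat_exp_def zero_less_mult_iff)

lemma bump_tendsto_indicator: "(\<lambda>m. bump a b m t) \<longlonglongrightarrow> indicator {a<..<b} t"
proof (cases "t \<in> {a<..<b}")
  case True
  have one: "(\<lambda>m. flat_exp 0 (real m * s)) \<longlonglongrightarrow> 1" if "s > 0" for s
  proof -
    have "(\<lambda>m. exp (- (inverse (real m) * inverse s))) \<longlonglongrightarrow> exp (- (0 * inverse s))"
      by (intro tendsto_intros lim_inverse_n)
    then have "(\<lambda>m. exp (- (inverse (real m) * inverse s))) \<longlonglongrightarrow> 1" by simp
    then show ?thesis
      by (rule Lim_transform_eventually)
        (use that in \<open>auto simp: flat_exp_def intro!: eventually_mono[OF eventually_gt_at_top[of 0]]\<close>)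
  qed
  have "(\<lambda>m. bump a b m t) \<longlonglongrightarrow> 1 * 1"
    unfolding bump_def by (intro tendsto_mult one) (use True in auto)
  then show ?thesis using True by simp
qed (simp add: bump_outside)

text \<open>
  The difference between a bump and its translate by \<open>r\<close> has mean zero, hence a compactly supported
  primitive. If \<open>H\<close> is any primitive of the bump, \<open>H(t) - H(t - r)\<close> is one, and the mean value theorem
  puts its values between \<open>0\<close> and \<open>r\<close>.
\<close>
lemma bump_difference_primitive:
  assumes "r > 0"
  obtains K where "\<And>k. smooth k K" "\<And>t. (K has_real_derivative bump a b m t - bump a b m (t - r)) (at t)"
    "\<And>t. 0 \<le> K t" "\<And>t. K t \<le> r" "\<And>t. t \<notin> {a..b + r} \<Longrightarrow> K t = 0"
proof -
  have c: "isCont (bump a b m) t" for t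
    using smooth_continuous[OF smooth_bump[of "Suc 0"]] .
  have "\<exists>H. \<forall>t::real. -\<infinity> < ereal t \<longrightarrow> ereal t < \<infinity> \<longrightarrow> (H has_vector_derivative bump a b m t) (at t)"
    by (rule einterval_antiderivative) (use c in simp_all)
  then obtain H where H: "\<And>t. (H has_real_derivative bump a b m t) (at t)"
    unfolding has_real_derivative_iff_has_vector_derivative by auto
  define K where "K t = H t - H (t - r)" for t
  have K': "(K has_real_derivative bump a b m t - bump a b m (t - r)) (at t)" for t
  proof -
    have H_shift: "((\<lambda>t. H (t - r)) has_real_derivative bump a b m (t - r)) (at t)"
      using H[of "t - r"] DERIV_shift[of H "bump a b m (t - r)" t "- r"] by simp
    have K_eq: "K = (\<lambda>t. H t - H (t - r))"
      by (rule ext) (rule K_def)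
    show ?thesis
      unfolding K_eq by (rule DERIV_diff[OF H H_shift])
  qed
  \<comment> \<open>One application of the mean value theorem to \<open>H\<close> gives the range and the support of \<open>K\<close>.\<close>
  have Kmv: "\<exists>z. t - r < z \<and> z < t \<and> K t = r * bump a b m z" for t
  proof -
    obtain z where "t - r < z" "z < t" "H t - H (t - r) = (t - (t - r)) * bump a b m z"
      using MVT2[of "t - r" t H "bump a b m", OF _ H] \<open>r > 0\<close> by auto
    then show ?thesis
      by (intro exI[of _ z]) (simp add: K_def)
  qed
  show thesis
  proof
    show "smooth k K" for k
    proof (cases k)
      case (Suc j)
      have "smooth j (\<lambda>t. bump a b m t + -1 * bump a b m (1 * t + - r))"
        by (rule smooth_add[OF smooth_bump smooth_mult[OF smooth_const smooth_affine[OF smooth_bump]]])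
      then show ?thesis
        unfolding Suc by (intro smooth_SucI[OF K']) simp
    qed simp
    show "(K has_real_derivative bump a b m t - bump a b m (t - r)) (at t)" for t
      by (rule K')
    fix t
    obtain z where z: "t - r < z" "z < t" "K t = r * bump a b m z"
      using Kmv by blast
    show "0 \<le> K t" "K t \<le> r"
      using z \<open>r > 0\<close> bump_range[of a b m z] by (auto simp: mult_left_le)
    show "K t = 0" if "t \<notin> {a..b + r}"
    proof -
      have "z \<notin> {a<..<b}" using z that by auto
      then show ?thesis using z bump_outside by simp
    qed
  qed
qed

section \<open>Test functions of product form\<close>
definition tensor :: "(2 \<Rightarrow> real \<Rightarrow> real) \<Rightarrow> real^2 \<Rightarrow> real" where
  "tensor A x = (\<Prod>j\<in>UNIV. A j (x $ j))"

lemma tensor_2: "tensor A x = A 1 (x $ 1) * A 2 (x $ 2)"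
  by (simp add: tensor_def UNIV_2)

lemma tensor_derivative:
  assumes "\<And>j t. (A j has_real_derivative A' j t) (at t)"
  shows "tensor A differentiable (at x)"
    and "pdiff i (tensor A) x = tensor (A(i := A' i)) x"
proof -
  have comp: "((\<lambda>x. A j (x $ j)) has_derivative (\<lambda>h. A' j (x $ j) * (h $ j))) (at x)" for j
  proof -
    have "(A j has_derivative (\<lambda>h. A' j (x $ j) * h)) (at (x $ j))"
      using assms by (simp add: has_field_derivative_def)
    from has_derivative_compose[OF bounded_linear_imp_has_derivative[OF bounded_linear_vec_nth] this] show ?thesis .
  qed
  have der: "(tensor A has_derivative (\<lambda>h. A 1 (x $ 1) * (A' 2 (x $ 2) * (h $ 2))
      + A' 1 (x $ 1) * (h $ 1) * A 2 (x $ 2))) (at x)"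
    unfolding tensor_2[abs_def] by (rule has_derivative_mult[OF comp comp])
  then show "tensor A differentiable (at x)"
    by (auto simp: differentiable_def)
  have "i = 1 \<or> i = 2" using exhaust_2 by blast
  then show "pdiff i (tensor A) x = tensor (A(i := A' i)) x"
    unfolding pdiff_def frechet_derivative_at[OF der, symmetric]
    by (auto simp: tensor_2 axis_def)
qed

text \<open>
  A partial derivative of a product of functions of one variable is again such a product, so the
  induction stays within this class.
\<close>
lemma diff_times_tensor:
  assumes "\<And>j. smooth k (A j)"
  shows "diff_times k (tensor A)"
  using assms
proof (induction k arbitrary: A)
  case (Suc k)
  have "\<forall>j. \<exists>f'. (\<forall>t. (A j has_real_derivative f' t) (at t)) \<and> smooth k f'"
    using Suc.prems by auto
  then obtain A' where A': "\<And>j t. (A j has_real_derivative A' j t) (at t)" "\<And>j. smooth k (A' j)"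
    by metis
  have "pdiff i (tensor A) = tensor (A(i := A' i))" for i
    using tensor_derivative(2)[of A A'] A'(1) by auto
  moreover have "diff_times k (tensor (A(i := A' i)))" for i
    by (rule Suc.IH) (use A'(2) Suc.prems smooth_Suc_D in auto)
  ultimately show ?case
    using tensor_derivative(1)[of A A'] A'(1) by auto
qed simp

lemma tensor_test_function:
  assumes smooth: "\<And>k j. smooth k (A j)"
    and support: "\<And>x. x \<notin> cbox a b \<Longrightarrow> tensor A x = 0" and "cbox a b \<subseteq> \<Omega>"
  shows "tensor A \<in> test_functions \<Omega>"
proof -
  have sub: "closure {x. tensor A x \<noteq> 0} \<subseteq> cbox a b"
    by (rule closure_minimal) (use support in auto)
  then have "compact (closure {x. tensor A x \<noteq> 0})"
    by (meson bounded_cbox bounded_subset closed_closure compact_eq_bounded_closed)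
  then show ?thesis
    using sub assms diff_times_tensor by (auto simp: test_functions_def)
qed

lemma pdiff_eqI:
  assumes "(f has_derivative D) (at x)"
  shows "pdiff i f x = D (axis i 1)"
  by (simp add: pdiff_def frechet_derivative_at[OF assms, symmetric])

lemma test_function_differentiable: "\<phi> \<in> test_functions \<Omega> \<Longrightarrow> \<phi> differentiable (at x)"
  using diff_times.simps(2)[of 0 \<phi>] by (auto simp: test_functions_def)

lemma test_function_continuous: "\<phi> \<in> test_functions \<Omega> \<Longrightarrow> continuous_on S \<phi>"
  by (meson continuous_at_imp_continuous_on differentiable_imp_continuous_within test_function_differentiable)

lemma test_function_measurable:
  "\<phi> \<in> test_functions \<Omega> \<Longrightarrow> \<phi> \<in> borel_measurable lebesgue"
  by (intro measurable_completion)
    (simp add: borel_measurable_continuous_onI test_function_continuous)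

lemma pdiff_test_function:
  assumes "\<phi> \<in> test_functions \<Omega>"
  shows "pdiff i \<phi> \<in> test_functions \<Omega>"
proof -
  let ?K = "closure {x. \<phi> x \<noteq> 0}"
  have "pdiff i \<phi> x = 0" if "x \<notin> ?K" for x
  proof -
    have 0: "0 = \<phi> y" if "y \<in> - ?K" for y
      using that closure_subset[of "{x. \<phi> x \<noteq> 0}"] by auto
    have "(\<phi> has_derivative (\<lambda>_. 0)) (at x)"
      by (rule has_derivative_transform_within_open[where f = "\<lambda>_. 0" and s = "- ?K", OF _ _ _ 0])
        (use that in \<open>simp_all only: has_derivative_const open_Compl closed_closure Compl_iff simp_thms\<close>)
    from pdiff_eqI[OF this] show ?thesis by simp
  qed
  then have "closure {x. pdiff i \<phi> x \<noteq> 0} \<subseteq> ?K"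
    by (intro closure_minimal) auto
  moreover have "diff_times k (pdiff i \<phi>)" for k
  proof -
    have "diff_times (Suc k) \<phi>"
      using assms unfolding test_functions_def by blast
    then show ?thesis unfolding diff_times.simps by blast
  qed
  moreover have "compact ?K" "?K \<subseteq> \<Omega>"
    using assms by (auto simp: test_functions_def)
  moreover from this have "compact (closure {x. pdiff i \<phi> x \<noteq> 0})"
    using \<open>closure {x. pdiff i \<phi> x \<noteq> 0} \<subseteq> ?K\<close>
    by (meson bounded_subset closed_closure compact_eq_bounded_closed)
  ultimately show ?thesis
    unfolding test_functions_def by blast
qed

lemma test_function_support:
  assumes "\<phi> \<in> test_functions \<Omega>"
  obtains K B where "compact K" "K \<subseteq> \<Omega>" "\<And>x. x \<notin> K \<Longrightarrow> \<phi> x = 0" "\<And>x. \<bar>\<phi> x\<bar> \<le> B" "B > 0"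
proof -
  let ?K = "closure {x. \<phi> x \<noteq> 0}"
  have K: "compact ?K" "?K \<subseteq> \<Omega>" using assms by (auto simp: test_functions_def)
  have 0: "\<phi> x = 0" if "x \<notin> ?K" for x using that closure_subset[of "{x. \<phi> x \<noteq> 0}"] by auto
  have "bounded (\<phi> ` ?K)"
    by (rule compact_imp_bounded[OF compact_continuous_image[OF test_function_continuous[OF assms] K(1)]])
  then obtain B where "B > 0" "\<forall>x\<in>\<phi> ` ?K. norm x \<le> B"
    unfolding bounded_pos by blast
  then have B: "B > 0" "\<And>x. x \<in> ?K \<Longrightarrow> \<bar>\<phi> x\<bar> \<le> B"
    by simp_all
  have "\<bar>\<phi> x\<bar> \<le> B" for x using 0[of x] B by (cases "x \<in> ?K") auto
  then show thesis using that K 0 B(1) by blast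
qed

text \<open>
  All pairings between a weak derivative and a test function are genuine integrals, never the default
  value \<open>0\<close> of a divergent one.
\<close>
lemma locally_integrable_times_test_function:
  assumes f: "locally_integrable \<Omega> f" and \<phi>: "\<phi> \<in> test_functions \<Omega>" and \<Omega>: "\<Omega> \<in> sets lebesgue"
  shows "integrable (lebesgue_on \<Omega>) (\<lambda>x. f x * \<phi> x)"
proof -
  obtain K B where K: "compact K" "K \<subseteq> \<Omega>" "\<And>x. x \<notin> K \<Longrightarrow> \<phi> x = 0" "\<And>x. \<bar>\<phi> x\<bar> \<le> B" "B > 0"
    using test_function_support[OF \<phi>] by metis
  have Ks: "K \<in> sets lebesgue" using K(1) by (simp add: compact_imp_closed)
  have "integrable (lebesgue_on K) f" using f K by (auto simp: locally_integrable_def)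
  then have F: "integrable lebesgue (\<lambda>x. indicator K x *\<^sub>R f x)"
    using Ks by (subst (asm) integrable_restrict_space) auto
  have "integrable lebesgue (\<lambda>x. (indicator K x *\<^sub>R f x) * \<phi> x)"
  proof (rule Bochner_Integration.integrable_bound)
    show "integrable lebesgue (\<lambda>x. B * (indicator K x *\<^sub>R f x))"
      using F by simp
    show "(\<lambda>x. (indicator K x *\<^sub>R f x) * \<phi> x) \<in> borel_measurable lebesgue"
      using borel_measurable_integrable[OF F] test_function_measurable[OF \<phi>] by (rule borel_measurable_times)
    show "AE x in lebesgue. norm (indicator K x *\<^sub>R f x * \<phi> x) \<le> norm (B * (indicator K x *\<^sub>R f x))"
    proof (rule AE_I2)
      fix x
      have "\<bar>f x\<bar> * \<bar>\<phi> x\<bar> \<le> \<bar>f x\<bar> * B"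
        using K(4) by (intro mult_left_mono) auto
      then show "norm (indicator K x *\<^sub>R f x * \<phi> x) \<le> norm (B * (indicator K x *\<^sub>R f x))"
        using K(5) by (simp add: abs_mult mult.commute indicator_def)
    qed
  qed
  moreover have "(\<lambda>x. (indicator K x *\<^sub>R f x) * \<phi> x) = (\<lambda>x. indicator \<Omega> x *\<^sub>R (f x * \<phi> x))"
    using K(2,3) by (force simp: indicator_def fun_eq_iff)
  ultimately show ?thesis
    using \<Omega> by (subst integrable_restrict_space) auto
qed

definition box_bump :: "real^2 \<Rightarrow> real^2 \<Rightarrow> nat \<Rightarrow> real^2 \<Rightarrow> real" where
  "box_bump a b m = tensor (\<lambda>j. bump (a $ j) (b $ j) m)"

lemma box_bump_range: "0 \<le> box_bump a b m x" "box_bump a b m x \<le> 1"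
  by (auto simp: box_bump_def tensor_2 bump_range intro: mult_le_one)

lemma box_bump_outside: "x \<notin> box a b \<Longrightarrow> box_bump a b m x = 0"
  by (auto simp: box_bump_def tensor_2 mem_box_cart forall_2 bump_outside)

lemma box_bump_test_function: "cbox a b \<subseteq> \<Omega> \<Longrightarrow> box_bump a b m \<in> test_functions \<Omega>"
  unfolding box_bump_def
  by (rule tensor_test_function[of _ a b], rule smooth_bump)
    (use box_bump_outside[of _ a b m] box_subset_cbox[of a b] in \<open>auto simp: box_bump_def\<close>)

lemma box_bump_tendsto_indicator: "(\<lambda>m. box_bump a b m x) \<longlonglongrightarrow> indicator (box a b) x"
proof -
  have "indicator (box a b) x = (indicator {a$1<..<b$1} (x$1) * indicator {a$2<..<b$2} (x$2) :: real)"
    by (auto simp: indicator_def mem_box_cart forall_2)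
  then show ?thesis
    unfolding box_bump_def tensor_2 by (auto intro!: tendsto_mult bump_tendsto_indicator)
qed

text \<open>
  Testing against smooth functions determines the integrals over boxes.
\<close>
lemma box_bump_integral_tendsto:
  assumes F: "integrable lebesgue F"
  shows "(\<lambda>m. integral\<^sup>L lebesgue (\<lambda>x. F x * box_bump a b m x)) \<longlonglongrightarrow> integral (cbox a b) F"
proof -
  have "integrable lebesgue (\<lambda>x. indicator (box a b) x *\<^sub>R F x)"
    using F by (intro integrable_mult_indicator) auto
  then have "integral (cbox a b) F = integral\<^sup>L lebesgue (\<lambda>x. F x * indicator (box a b) x)"
    using set_lebesgue_integral_eq_integral(2)[of "box a b" F]
    by (simp add: set_integrable_def set_lebesgue_integral_def integral_open_interval mult.commute)
  moreover have "(\<lambda>m. integral\<^sup>L lebesgue (\<lambda>x. F x * box_bump a b m x))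
      \<longlonglongrightarrow> integral\<^sup>L lebesgue (\<lambda>x. F x * indicator (box a b) x)"
  proof (rule integral_dominated_convergence)
    show "integrable lebesgue (\<lambda>x. \<bar>F x\<bar>)" using F by simp
    show "(\<lambda>x. F x * indicator (box a b) x) \<in> borel_measurable lebesgue"
      by (intro borel_measurable_times borel_measurable_integrable[OF F] borel_measurable_indicator) auto
    show "(\<lambda>x. F x * box_bump a b m x) \<in> borel_measurable lebesgue" for m
      using test_function_measurable[OF box_bump_test_function[of a b UNIV m]]
      by (intro borel_measurable_times borel_measurable_integrable[OF F]) auto
    show "AE x in lebesgue. (\<lambda>m. F x * box_bump a b m x) \<longlonglongrightarrow> F x * indicator (box a b) x"
      by (intro AE_I2 tendsto_mult tendsto_const box_bump_tendsto_indicator)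
    show "AE x in lebesgue. norm (F x * box_bump a b m x) \<le> \<bar>F x\<bar>" for m
      using box_bump_range[of a b m] by (auto simp: abs_mult mult_left_le)
  qed
  ultimately show ?thesis by simp
qed

section \<open>Uniqueness of weak derivatives\<close>
lemma integrable_lebesgue_imp_integrable_on_cbox:
  fixes F :: "real^2 \<Rightarrow> real"
  assumes "integrable lebesgue F"
  shows "F integrable_on cbox a b"
proof -
  have "F absolutely_integrable_on cbox a b"
    using integrable_mult_indicator[OF _ assms, of "cbox a b"] by (simp add: set_integrable_def)
  then show ?thesis
    using absolutely_integrable_on_def by blast
qed

lemma sum_Basis_nth: "(\<Sum>x\<in>(Basis :: (real^2) set). x $ j) = 1"
proof -
  have "(\<Sum>x\<in>(Basis :: (real^2) set). x $ j) = (\<Sum>x\<in>(Basis :: (real^2) set). x \<bullet> axis j 1)"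
    by (intro sum.cong refl) (metis cart_eq_inner_axis)
  also have "\<dots> = One \<bullet> (axis j 1 :: real^2)"
    by (rule inner_sum_left[symmetric])
  also have "\<dots> = 1"
    using inner_sum_left_Basis[of "axis j 1 :: real^2" "\<lambda>_. 1"]
    by (simp only: scaleR_one axis_in_Basis_iff Basis_real_def singleton_iff simp_thms)
  finally show ?thesis .
qed

lemma AE_negligibleI:
  assumes "negligible N" "\<And>x. x \<notin> N \<Longrightarrow> P x"
  shows "AE x in lebesgue. P x"
  using assms by (intro AE_I'[of N]) (auto simp: negligible_iff_null_sets)

lemma AE_obtain_negligible:
  assumes "AE x in lebesgue. P x"
  obtains N where "negligible N" "\<And>x. x \<notin> N \<Longrightarrow> P x"
  using assms unfolding completion.AE_iff_null_sets negligible_iff_null_sets by auto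

text \<open>
  Almost every point is a Lebesgue point, where the value is the limit of the means over small squares
  with that point as lower left corner.
\<close>
lemma AE_zero_of_box_integrals:
  fixes F :: "real^2 \<Rightarrow> real"
  assumes F: "integrable lebesgue F"
    and zero: "\<And>c d. cbox c d \<subseteq> cbox a b \<Longrightarrow> integral (cbox c d) F = 0"
  shows "AE x in lebesgue. x \<in> cbox a b \<longrightarrow> F x = 0"
proof -
  obtain N where N: "negligible N"
    and lim: "\<And>x e. \<lbrakk>x \<notin> N; 0 < e\<rbrakk> \<Longrightarrow> \<exists>d>0. \<forall>h. 0 < h \<and> h < d \<longrightarrow>
        norm (integral (cbox x (x + h *\<^sub>R One)) F /\<^sub>R h ^ DIM(real^2) - F x) < e"
    using integrable_ccontinuous_explicit[of F] integrable_lebesgue_imp_integrable_on_cbox[OF F] by metis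
  have "F x = 0" if x: "x \<in> box a b" "x \<notin> N" for x
  proof (rule ccontr)
    assume "F x \<noteq> 0"
    then obtain d where d: "d > 0" "\<And>h. 0 < h \<Longrightarrow> h < d \<Longrightarrow>
        norm (integral (cbox x (x + h *\<^sub>R One)) F /\<^sub>R h ^ DIM(real^2) - F x) < \<bar>F x\<bar>"
      using lim[of x "\<bar>F x\<bar>"] x by auto
    define h where "h = min (d / 2) (min (b $ 1 - x $ 1) (b $ 2 - x $ 2))"
    have h: "0 < h" "h < d" "h \<le> b $ 1 - x $ 1" "h \<le> b $ 2 - x $ 2"
      using d x by (auto simp: h_def mem_box_cart forall_2)
    have "cbox x (x + h *\<^sub>R One) \<subseteq> cbox a b"
      using x h by (auto simp: mem_box_cart forall_2 sum_Basis_nth)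
    from zero[OF this] d(2)[OF h(1,2)] show False by simp
  qed
  moreover have "negligible (N \<union> (cbox a b - box a b))"
    by (intro negligible_Un N negligible_frontier_interval)
  ultimately show ?thesis
    by (intro AE_negligibleI[of "N \<union> (cbox a b - box a b)"]) auto
qed

text \<open>
  The fundamental lemma of the calculus of variations: the difference of two weak derivatives is
  orthogonal to all box bumps, so its integrals over boxes vanish.
\<close>
lemma weak_pdiff_unique:
  assumes \<Omega>: "open \<Omega>" and g: "is_weak_pdiff \<Omega> i f g" and g': "is_weak_pdiff \<Omega> i f g'"
  shows "AE x in lebesgue_on \<Omega>. g x = g' x"
proof -
  have [simp]: "\<Omega> \<in> sets lebesgue" using \<Omega> by auto
  have loc: "locally_integrable \<Omega> g" and loc': "locally_integrable \<Omega> g'"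
    and wg: "\<And>\<phi>. \<phi> \<in> test_functions \<Omega> \<Longrightarrow> L2_inner \<Omega> f (pdiff i \<phi>) = - L2_inner \<Omega> g \<phi>"
    and wg': "\<And>\<phi>. \<phi> \<in> test_functions \<Omega> \<Longrightarrow> L2_inner \<Omega> f (pdiff i \<phi>) = - L2_inner \<Omega> g' \<phi>"
    using g g' unfolding is_weak_pdiff_def by blast+
  have local: "AE x in lebesgue. x \<in> cbox a b \<longrightarrow> g x = g' x" if ab: "cbox a b \<subseteq> \<Omega>" for a b
  proof -
    define F where "F x = indicator (cbox a b) x *\<^sub>R (g x - g' x)" for x
    have "integrable (lebesgue_on (cbox a b)) (\<lambda>x. g x - g' x)"
      using loc loc' ab unfolding locally_integrable_def
      by (intro Bochner_Integration.integrable_diff) auto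
    then have F: "integrable lebesgue F"
      unfolding F_def by (subst (asm) integrable_restrict_space) auto
    have zero: "integral (cbox c d) F = 0" if cd: "cbox c d \<subseteq> cbox a b" for c d
    proof -
      have "integral\<^sup>L lebesgue (\<lambda>x. F x * box_bump c d m x) = 0" for m
      proof -
        have \<phi>: "box_bump c d m \<in> test_functions \<Omega>"
          using cd ab by (intro box_bump_test_function) auto
        have "integral\<^sup>L (lebesgue_on \<Omega>) (\<lambda>x. g x * box_bump c d m x - g' x * box_bump c d m x) = 0"
          using wg[OF \<phi>] wg'[OF \<phi>] \<phi>
          by (subst Bochner_Integration.integral_diff)
            (simp_all add: locally_integrable_times_test_function L2_inner_def loc loc')
        then have "integral\<^sup>L lebesgue (\<lambda>x. indicator \<Omega> x *\<^sub>R (g x * box_bump c d m x - g' x * box_bump c d m x)) = 0"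
          by (subst (asm) integral_restrict_space) auto
        moreover have "indicator \<Omega> x *\<^sub>R (g x * box_bump c d m x - g' x * box_bump c d m x)
            = F x * box_bump c d m x" for x
          using ab cd box_bump_outside[of x c d m] box_subset_cbox[of c d]
          by (cases "x \<in> box c d") (auto simp: F_def indicator_def algebra_simps)
        ultimately show ?thesis by simp
      qed
      then show ?thesis
        using box_bump_integral_tendsto[OF F, of c d] by (simp add: LIMSEQ_const_iff)
    qed
    show ?thesis
      using AE_zero_of_box_integrals[OF F zero, of a b]
      by (rule eventually_mono) (auto simp: F_def indicator_def split: if_splits)
  qed
  obtain D where D: "countable D" "D \<subseteq> Pow \<Omega>" "\<And>X. X \<in> D \<Longrightarrow> \<exists>a b. X = cbox a b" "\<Union>D = \<Omega>"
    by (rule open_countable_Union_open_cbox[OF \<Omega>]) (rule that)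
  have "AE x in lebesgue. \<forall>X\<in>D. x \<in> X \<longrightarrow> g x = g' x"
  proof (subst AE_ball_countable[OF D(1)], intro ballI)
    fix X assume "X \<in> D"
    then obtain a b where "X = cbox a b" "cbox a b \<subseteq> \<Omega>"
      using D(2) D(3)[of X] by blast
    then show "AE x in lebesgue. x \<in> X \<longrightarrow> g x = g' x"
      using local by simp
  qed
  then have "AE x in lebesgue. x \<in> \<Omega> \<longrightarrow> g x = g' x"
    by (rule eventually_mono) (use D(4) in blast)
  then show ?thesis by (subst AE_restrict_space_iff) auto
qed

section \<open>Bounded weak derivatives and Lipschitz continuity\<close>
text \<open>
  How much the integral of \<open>f\<close> changes when a box is moved in direction \<open>i\<close>. The difference of the
  bumps of the two boxes is the partial derivative of a test function \<open>\<psi>\<close> with \<open>0 \<le> \<psi> \<le> r\<close>, supported in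
  the box \<open>cbox a (b + r *\<^sub>R axis i 1)\<close> that contains both; moving the derivative from \<open>\<psi>\<close> to \<open>f\<close> gives
  the bound.
\<close>
lemma box_integral_shift_bound:
  fixes f g :: "real^2 \<Rightarrow> real"
  assumes \<Omega>: "open \<Omega>" and f: "integrable (lebesgue_on \<Omega>) f" and g: "is_weak_pdiff \<Omega> i f g"
    and C: "AE x in lebesgue_on \<Omega>. \<bar>g x\<bar> \<le> C" "C \<ge> 0"
    and r: "r > 0" and sub: "cbox a (b + r *\<^sub>R axis i 1) \<subseteq> \<Omega>"
  defines "F \<equiv> \<lambda>x. indicator \<Omega> x *\<^sub>R f x"
  shows "\<bar>integral (cbox (a + r *\<^sub>R axis i 1) (b + r *\<^sub>R axis i 1)) F - integral (cbox a b) F\<bar>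
    \<le> C * r * measure lborel (cbox a (b + r *\<^sub>R axis i 1))"
proof -
  let ?e = "r *\<^sub>R axis i 1 :: real^2"
  have [simp]: "\<Omega> \<in> sets lebesgue" using \<Omega> by auto
  have F: "integrable lebesgue F"
    using f unfolding F_def by (subst (asm) integrable_restrict_space) auto
  have bound: "\<bar>integral\<^sup>L lebesgue (\<lambda>x. F x * box_bump a b m x) - integral\<^sup>L lebesgue (\<lambda>x. F x * box_bump (a + ?e) (b + ?e) m x)\<bar>
      \<le> C * r * measure lborel (cbox a (b + ?e))" for m
  proof -
    obtain K where K: "\<And>k. smooth k K"
      "\<And>t. (K has_real_derivative bump (a$i) (b$i) m t - bump (a$i) (b$i) m (t - r)) (at t)"
      "\<And>t. 0 \<le> K t" "\<And>t. K t \<le> r" "\<And>t. t \<notin> {a$i..b$i + r} \<Longrightarrow> K t = 0"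
      using bump_difference_primitive[OF r] by metis
    define A where "A = (\<lambda>j. bump (a $ j) (b $ j) m)(i := K)"
    define \<psi> where "\<psi> = tensor A"
    have i: "i = 1 \<or> i = 2" using exhaust_2 by blast
    have outside: "\<psi> x = 0" if "x \<notin> cbox a (b + ?e)" for x
    proof -
      obtain j where j: "\<not> (a $ j \<le> x $ j \<and> x $ j \<le> b $ j + ?e $ j)"
        using \<open>x \<notin> cbox a (b + ?e)\<close> by (auto simp: mem_box_cart)
      then have "A j (x $ j) = 0"
        using K(5)[of "x $ j"] bump_outside[of "x $ j" "a $ j" "b $ j" m]
        by (cases "j = i") (auto simp: A_def axis_def)
      then show ?thesis by (auto simp: \<psi>_def tensor_def)
    qed
    have smooth_A: "smooth k (A j)" for k j
      by (auto simp: A_def K(1) smooth_bump)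
    have \<psi>: "\<psi> \<in> test_functions \<Omega>"
      unfolding \<psi>_def using smooth_A outside sub by (intro tensor_test_function) (auto simp: \<psi>_def)
    have range: "0 \<le> \<psi> x \<and> \<psi> x \<le> r" for x
      using i K(3,4) bump_range r
      by (auto simp: \<psi>_def tensor_2 A_def intro: mult_right_le_one_le[THEN order_trans] mult_left_le_one_le[THEN order_trans])
    have \<psi>': "pdiff i \<psi> x = box_bump a b m x - box_bump (a + ?e) (b + ?e) m x" for x
    proof -
      have "\<exists>A'. \<forall>t. (A j has_real_derivative A' t) (at t)" for j
        using smooth_A[of "Suc 0" j] by simp
      then obtain A' where A': "\<And>j t. (A j has_real_derivative A' j t) (at t)" by metis
      have "A' i t = bump (a$i) (b$i) m t - bump (a$i) (b$i) m (t - r)" for t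
        using DERIV_unique[OF A'[of i t]] K(2)[of t] by (simp add: A_def)
      moreover have "bump (s + r) (s' + r) m t = bump s s' m (t - r)" for s s' t
        by (simp add: bump_def algebra_simps)
      ultimately show ?thesis
        unfolding \<psi>_def tensor_derivative(2)[of A, OF A']
        using i by (auto simp: A_def box_bump_def tensor_2 axis_def left_diff_distrib right_diff_distrib)
    qed
    have "integral\<^sup>L (lebesgue_on \<Omega>) (\<lambda>x. f x * pdiff i \<psi> x) = - integral\<^sup>L (lebesgue_on \<Omega>) (\<lambda>x. g x * \<psi> x)"
      using g \<psi> by (auto simp: is_weak_pdiff_def L2_inner_def)
    moreover have "integral\<^sup>L (lebesgue_on \<Omega>) (\<lambda>x. f x * pdiff i \<psi> x)
        = integral\<^sup>L lebesgue (\<lambda>x. F x * box_bump a b m x) - integral\<^sup>L lebesgue (\<lambda>x. F x * box_bump (a + ?e) (b + ?e) m x)"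
    proof -
      have int: "integrable lebesgue (\<lambda>x. F x * box_bump c d m x)" for c d
      proof (rule Bochner_Integration.integrable_bound[OF F])
        show "(\<lambda>x. F x * box_bump c d m x) \<in> borel_measurable lebesgue"
          using test_function_measurable[OF box_bump_test_function[of c d UNIV m]]
          by (intro borel_measurable_times borel_measurable_integrable[OF F]) auto
        show "AE x in lebesgue. norm (F x * box_bump c d m x) \<le> norm (F x)"
          using box_bump_range[of c d m] by (auto simp: abs_mult mult_left_le)
      qed
      have "integral\<^sup>L (lebesgue_on \<Omega>) (\<lambda>x. f x * pdiff i \<psi> x) = integral\<^sup>L lebesgue (\<lambda>x. F x * pdiff i \<psi> x)"
        by (subst integral_restrict_space) (simp_all add: F_def mult.assoc)
      also have "\<dots> = integral\<^sup>L lebesgue (\<lambda>x. F x * box_bump a b m x - F x * box_bump (a + ?e) (b + ?e) m x)"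
        by (simp add: \<psi>' right_diff_distrib)
      finally show ?thesis by (simp add: Bochner_Integration.integral_diff[OF int int])
    qed
    moreover have "\<bar>integral\<^sup>L (lebesgue_on \<Omega>) (\<lambda>x. g x * \<psi> x)\<bar> \<le> C * r * measure lborel (cbox a (b + ?e))"
    proof -
      have int: "integrable (lebesgue_on \<Omega>) (\<lambda>x. g x * \<psi> x)"
        using g \<psi> by (intro locally_integrable_times_test_function) (auto simp: is_weak_pdiff_def)
      have fin: "integrable lebesgue (\<lambda>x. indicator (cbox a (b + ?e)) x :: real)"
        by (rule integrable_real_indicator) (auto simp: emeasure_lborel_cbox_eq)
      have int_space: "\<Omega> \<inter> space lebesgue \<in> sets lebesgue" by simp
      have "(\<lambda>x. indicator \<Omega> x *\<^sub>R (C * r * indicator (cbox a (b + ?e)) x)) = (\<lambda>x. C * r * indicator (cbox a (b + ?e)) x)"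
        using sub by (force simp: indicator_def)
      then have int': "integrable (lebesgue_on \<Omega>) (\<lambda>x. C * r * indicator (cbox a (b + ?e)) x)"
        and eq': "integral\<^sup>L (lebesgue_on \<Omega>) (\<lambda>x. C * r * indicator (cbox a (b + ?e)) x) = C * r * measure lborel (cbox a (b + ?e))"
        using fin by (simp_all only: integrable_restrict_space integral_restrict_space int_space
            integrable_mult_right Bochner_Integration.integral_mult_right) simp
      have "\<bar>integral\<^sup>L (lebesgue_on \<Omega>) (\<lambda>x. g x * \<psi> x)\<bar> \<le> integral\<^sup>L (lebesgue_on \<Omega>) (\<lambda>x. \<bar>g x * \<psi> x\<bar>)"
        using integral_norm_bound[of "lebesgue_on \<Omega>" "\<lambda>x. g x * \<psi> x"] by simp
      also have "\<dots> \<le> integral\<^sup>L (lebesgue_on \<Omega>) (\<lambda>x. C * r * indicator (cbox a (b + ?e)) x)"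
      proof (rule integral_mono_AE)
        show "AE x in lebesgue_on \<Omega>. \<bar>g x * \<psi> x\<bar> \<le> C * r * indicator (cbox a (b + ?e)) x"
          using C(1)
        proof (eventually_elim)
          case (elim x)
          then show ?case
            using range[of x] outside[of x] C(2)
            by (cases "x \<in> cbox a (b + ?e)") (auto simp: abs_mult intro!: mult_mono)
        qed
      qed (use int int' in auto)
      finally show ?thesis unfolding eq' .
    qed
    ultimately show ?thesis by simp
  qed
  have "(\<lambda>m. \<bar>integral\<^sup>L lebesgue (\<lambda>x. F x * box_bump a b m x) - integral\<^sup>L lebesgue (\<lambda>x. F x * box_bump (a + ?e) (b + ?e) m x)\<bar>)
    \<longlonglongrightarrow> \<bar>integral (cbox a b) F - integral (cbox (a + ?e) (b + ?e)) F\<bar>"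
    by (intro tendsto_intros box_bump_integral_tendsto F)
  then have "\<bar>integral (cbox a b) F - integral (cbox (a + ?e) (b + ?e)) F\<bar> \<le> C * r * measure lborel (cbox a (b + ?e))"
    by (rule LIMSEQ_le_const2) (use bound in auto)
  then show ?thesis by (simp add: abs_minus_commute)
qed

text \<open>
  The values of \<open>f\<close> at two Lebesgue points on a line in direction \<open>i\<close> are limits of means over small
  squares at these points. A square of side \<open>r = h / k\<close> is carried from one point to the other in \<open>k\<close>
  moves by \<open>r\<close>, each of which changes the mean by at most \<open>2 C r\<close>, because a square and its translate by
  its own side length cover a rectangle of area \<open>2 r\<^sup>2\<close>.
\<close>
lemma weak_pdiff_bounded_imp_Lipschitz:
  fixes f g :: "real^2 \<Rightarrow> real"
  assumes \<Omega>: "open \<Omega>" "convex \<Omega>" and f: "integrable (lebesgue_on \<Omega>) f" and g: "is_weak_pdiff \<Omega> i f g"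
    and C: "AE x in lebesgue_on \<Omega>. \<bar>g x\<bar> \<le> C" "C \<ge> 0"
  obtains N where "negligible N"
    "\<And>x h. \<lbrakk>h > 0; x \<in> \<Omega> - N; x + h *\<^sub>R axis i 1 \<in> \<Omega> - N\<rbrakk> \<Longrightarrow> \<bar>f (x + h *\<^sub>R axis i 1) - f x\<bar> \<le> 2 * C * h"
proof -
  let ?e = "axis i 1 :: real^2"
  define F where "F = (\<lambda>x. indicator \<Omega> x *\<^sub>R f x)"
  have F: "integrable lebesgue F"
    using f \<Omega>(1) unfolding F_def by (subst (asm) integrable_restrict_space) auto
  obtain N where N: "negligible N"
    and lim: "\<And>x e. \<lbrakk>x \<notin> N; 0 < e\<rbrakk> \<Longrightarrow> \<exists>d>0. \<forall>h. 0 < h \<and> h < d \<longrightarrow>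
        norm (integral (cbox x (x + h *\<^sub>R One)) F /\<^sub>R h ^ DIM(real^2) - F x) < e"
    using integrable_ccontinuous_explicit[of F] integrable_lebesgue_imp_integrable_on_cbox[OF F] by metis
  have "\<bar>f (x + h *\<^sub>R ?e) - f x\<bar> \<le> 2 * C * h"
    if h: "h > 0" and x: "x \<in> \<Omega> - N" and xh: "x + h *\<^sub>R ?e \<in> \<Omega> - N" for x h
  proof (rule field_le_epsilon)
    fix \<epsilon> :: real assume "\<epsilon> > 0"
    then obtain d1 where d1: "d1 > 0" "\<And>r. 0 < r \<Longrightarrow> r < d1 \<Longrightarrow>
        norm (integral (cbox x (x + r *\<^sub>R One)) F /\<^sub>R r ^ DIM(real^2) - F x) < \<epsilon> / 2"
      using lim[of x "\<epsilon> / 2"] x by auto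
    obtain d2 where d2: "d2 > 0" "\<And>r. 0 < r \<Longrightarrow> r < d2 \<Longrightarrow>
        norm (integral (cbox (x + h *\<^sub>R ?e) (x + h *\<^sub>R ?e + r *\<^sub>R One)) F /\<^sub>R r ^ DIM(real^2) - F (x + h *\<^sub>R ?e)) < \<epsilon> / 2"
      using lim[of "x + h *\<^sub>R ?e" "\<epsilon> / 2"] xh \<open>\<epsilon> > 0\<close> by auto
    have seg: "closed_segment x (x + h *\<^sub>R ?e) \<subseteq> \<Omega>"
      using x xh \<Omega>(2) by (intro closed_segment_subset) auto
    then obtain d3 where d3: "d3 > 0" "(\<Union>z\<in>closed_segment x (x + h *\<^sub>R ?e). ball z d3) \<subseteq> \<Omega>"
      using compact_subset_open_imp_ball_epsilon_subset[OF compact_segment \<Omega>(1)] by metis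
    obtain k :: nat where k: "k > 0" "h / real k < min d1 (min d2 (d3 / 4))"
    proof -
      let ?d = "min d1 (min d2 (d3 / 4))"
      obtain k :: nat where "h / ?d < real k" using reals_Archimedean2 by blast
      moreover have "?d > 0" using d1 d2 d3 by auto
      moreover from calculation h have "0 < real k"
        by (meson divide_pos_pos order_less_trans)
      ultimately show thesis
        using that[of k] by (simp only: of_nat_0_less_iff pos_divide_less_eq mult.commute)
    qed
    \<comment> \<open>The side length is below the radii \<open>d1\<close>, \<open>d2\<close> of the two Lebesgue points and so small that
      all squares on the way, and their translates, stay inside \<open>\<Omega>\<close>.\<close>
    define r where "r = h / k"
    have r: "r > 0" "r < d1" "r < d2" "r < d3 / 4" "real k * r = h"
      using k h by (auto simp: r_def)
    define A where "A j = integral (cbox (x + (real j * r) *\<^sub>R ?e) (x + (real j * r) *\<^sub>R ?e + r *\<^sub>R One)) F" for j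
    have step: "\<bar>A (Suc j) - A j\<bar> \<le> C * r * (2 * r^2)" if "j < k" for j
    proof -
      define z where "z = x + (real j * r) *\<^sub>R ?e"
      have z: "z \<in> closed_segment x (x + h *\<^sub>R ?e)"
        unfolding closed_segment_def z_def using \<open>j < k\<close> r
        by (intro CollectI exI[of _ "real j / real k"]) (auto simp: algebra_simps r_def)
      have sub: "cbox z (z + r *\<^sub>R One + r *\<^sub>R ?e) \<subseteq> \<Omega>"
      proof
        fix y assume y: "y \<in> cbox z (z + r *\<^sub>R One + r *\<^sub>R ?e)"
        have "\<bar>(z - y) $ j\<bar> \<le> 2 * r" for j
          using y r(1) by (auto simp: mem_box_cart sum_Basis_nth axis_def dest!: spec[of _ j] split: if_splits)
        then have "norm (z - y) \<le> (\<Sum>j\<in>(UNIV::2 set). 2 * r)"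
          by (intro norm_le_l1_cart[THEN order_trans] sum_mono)
        then have "dist z y < d3" using r by (simp add: dist_norm UNIV_2)
        then show "y \<in> \<Omega>" using d3(2) z by (meson UN_I mem_ball subsetD)
      qed
      have i: "i = 1 \<or> i = 2" using exhaust_2 by blast
      have "measure lborel (cbox z (z + r *\<^sub>R One + r *\<^sub>R ?e)) = 2 * r^2"
        using r(1) i by (subst content_cbox_cart)
          (auto simp: interval_ne_empty_cart sum_Basis_nth axis_def UNIV_2 power2_eq_square)
      moreover have "A j = integral (cbox z (z + r *\<^sub>R One)) F"
        by (simp only: A_def z_def)
      moreover have "A (Suc j) = integral (cbox (z + r *\<^sub>R ?e) (z + r *\<^sub>R One + r *\<^sub>R ?e)) F"
      proof -
        have "x + (real (Suc j) * r) *\<^sub>R ?e = z + r *\<^sub>R ?e"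
          by (simp add: z_def algebra_simps)
        then show ?thesis by (simp only: A_def add.assoc add.commute add.left_commute)
      qed
      ultimately show ?thesis
        using box_integral_shift_bound[OF \<Omega>(1) f g C r(1) sub] by (simp only: F_def)
    qed
    have "\<bar>A k - A 0\<bar> = \<bar>\<Sum>j<k. (A (Suc j) - A j)\<bar>"
      by (simp add: sum_lessThan_telescope)
    also have "\<dots> \<le> (\<Sum>j<k. C * r * (2 * r^2))"
      by (intro sum_abs[THEN order_trans] sum_mono step) auto
    also have "\<dots> = (2 * C * h) * r^2"
      using r(5) by (simp add: algebra_simps)
    finally have "\<bar>A k /\<^sub>R r^2 - A 0 /\<^sub>R r^2\<bar> \<le> 2 * C * h"
      using r(1) by (simp add: diff_divide_distrib[symmetric] abs_divide divide_simps inverse_eq_divide)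
    moreover have "\<bar>A 0 /\<^sub>R r^2 - f x\<bar> < \<epsilon> / 2"
      using d1(2)[OF r(1,2)] x by (simp add: A_def F_def indicator_def)
    moreover have "\<bar>A k /\<^sub>R r^2 - f (x + h *\<^sub>R ?e)\<bar> < \<epsilon> / 2"
      using d2(2)[OF r(1,3)] xh r(5) by (simp add: A_def F_def indicator_def)
    ultimately show "\<bar>f (x + h *\<^sub>R ?e) - f x\<bar> \<le> 2 * C * h + \<epsilon>" by linarith
  qed
  then show thesis using that N by blast
qed

section \<open>Difference quotients that converge boundedly\<close>
lemma integrable_imp_locally_integrable:
  assumes "integrable (lebesgue_on \<Omega>) f" "\<Omega> \<in> sets lebesgue"
  shows "locally_integrable \<Omega> f"
  unfolding locally_integrable_def
proof (intro allI impI)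
  fix K assume K: "compact K \<and> K \<subseteq> \<Omega>"
  then have Ks: "K \<in> sets lebesgue" by (auto simp: compact_imp_closed)
  have "integrable lebesgue (\<lambda>x. indicator \<Omega> x *\<^sub>R f x)"
    using assms by (subst (asm) integrable_restrict_space) auto
  then have "integrable lebesgue (\<lambda>x. indicator K x *\<^sub>R (indicator \<Omega> x *\<^sub>R f x))"
    by (rule integrable_mult_indicator[OF Ks])
  also have "(\<lambda>x. indicator K x *\<^sub>R (indicator \<Omega> x *\<^sub>R f x)) = (\<lambda>x. indicator K x *\<^sub>R f x)"
    using K by (auto simp: indicator_def fun_eq_iff)
  finally show "integrable (lebesgue_on K) f"
    using Ks by (subst integrable_restrict_space) auto
qed

lemma integrable_bounded:
  fixes f :: "real^2 \<Rightarrow> real"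
  assumes "open \<Omega>" "bounded \<Omega>" "f \<in> borel_measurable (lebesgue_on \<Omega>)" "AE x in lebesgue_on \<Omega>. \<bar>f x\<bar> \<le> C"
  shows "integrable (lebesgue_on \<Omega>) f"
proof -
  interpret finite_measure "lebesgue_on \<Omega>"
    using assms by (intro finite_measure_lebesgue_on lmeasurable_open)
  show ?thesis
    using assms by (intro integrable_const_bound[of _ C]) auto
qed

lemma lebesgue_integral_translation:
  fixes F :: "'a::euclidean_space \<Rightarrow> real"
  assumes "F \<in> borel_measurable lebesgue"
  shows "integral\<^sup>L lebesgue (\<lambda>x. F (a + x)) = integral\<^sup>L lebesgue F"
    and "(\<lambda>x. F (a + x)) \<in> borel_measurable lebesgue"
    and "integrable lebesgue F \<Longrightarrow> integrable lebesgue (\<lambda>x. F (a + x))"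
proof -
  have T: "(\<lambda>x. a + (\<Sum>j\<in>Basis. (1 * (x \<bullet> j)) *\<^sub>R j)) = (+) a"
    by (simp add: euclidean_representation)
  have eq: "lebesgue = distr lebesgue lebesgue ((+) a)"
    using lebesgue_affine_euclidean[of "\<lambda>_. 1" a] unfolding T by (simp add: density_1)
  have meas: "(+) a \<in> lebesgue \<rightarrow>\<^sub>M lebesgue"
    using lebesgue_affine_measurable[of "\<lambda>_. 1" a] unfolding T by simp
  show "integral\<^sup>L lebesgue (\<lambda>x. F (a + x)) = integral\<^sup>L lebesgue F"
    by (subst (2) eq) (simp only: integral_distr[OF meas assms])
  show "(\<lambda>x. F (a + x)) \<in> borel_measurable lebesgue"
    by (rule measurable_compose[OF meas assms])
  show "integrable lebesgue (\<lambda>x. F (a + x))" if "integrable lebesgue F"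
    using that by (subst (asm) eq) (simp only: integrable_distr_eq[OF meas assms])
qed

lemma AE_translation:
  fixes a :: "'a::euclidean_space"
  assumes "AE x in lebesgue. P x"
  shows "AE x in lebesgue. P (x + a)"
proof -
  obtain N where N: "negligible N" "\<And>x. x \<notin> N \<Longrightarrow> P x"
    using AE_obtain_negligible[OF assms] by metis
  show ?thesis
  proof (rule AE_negligibleI)
    show "negligible ((+) (- a) ` N)" by (rule negligible_translation[OF N(1)])
    show "P (x + a)" if "x \<notin> (+) (- a) ` N" for x
      using that by (intro N(2)) (force simp: image_iff)
  qed
qed

definition line_derivative :: "2 \<Rightarrow> (real^2 \<Rightarrow> real) \<Rightarrow> (real^2 \<Rightarrow> real) \<Rightarrow> bool" where
  "line_derivative i f f' \<longleftrightarrow>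
     (\<forall>x t. ((\<lambda>t. f (x + t *\<^sub>R axis i 1)) has_real_derivative f' (x + t *\<^sub>R axis i 1)) (at t))"

lemma line_derivative_pdiff:
  assumes "\<And>x. f differentiable (at x)"
  shows "line_derivative i f (pdiff i f)"
  unfolding line_derivative_def
proof (intro allI)
  fix x :: "real^2" and t :: real
  let ?y = "x + t *\<^sub>R axis i 1"
  let ?D = "frechet_derivative f (at ?y)"
  have f: "(f has_derivative ?D) (at ?y)"
    using assms frechet_derivative_works by blast
  have "((\<lambda>t. x + t *\<^sub>R axis i 1) has_derivative (\<lambda>h. h *\<^sub>R axis i 1)) (at t)"
    by (auto intro!: derivative_eq_intros)
  from has_derivative_compose[OF this f]
  have "((\<lambda>t. f (x + t *\<^sub>R axis i 1)) has_derivative (\<lambda>h. ?D (h *\<^sub>R axis i 1))) (at t)" .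
  moreover have "?D (h *\<^sub>R axis i 1) = pdiff i f ?y * h" for h
    using linear_cmul[OF has_derivative_linear[OF f]] by (simp add: pdiff_def)
  ultimately show "((\<lambda>t. f (x + t *\<^sub>R axis i 1)) has_real_derivative pdiff i f ?y) (at t)"
    by (simp add: has_field_derivative_def)
qed

lemma line_derivative_quotient_tendsto:
  assumes f: "line_derivative i f f'" and h: "h \<longlonglongrightarrow> 0" "\<And>n. h n \<noteq> 0"
  shows "(\<lambda>n. (f (x + h n *\<^sub>R axis i 1) - f x) / h n) \<longlonglongrightarrow> f' x"
proof -
  have "((\<lambda>t. f (x + t *\<^sub>R axis i 1)) has_real_derivative f' x) (at 0)"
    using f[unfolded line_derivative_def, rule_format, of x 0] by simp
  then have "((\<lambda>t. (f (x + t *\<^sub>R axis i 1) - f x) / t) \<longlongrightarrow> f' x) (at 0)"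
    by (simp add: DERIV_def)
  moreover have "filterlim h (at 0) sequentially"
    using h by (auto simp: filterlim_at)
  ultimately show ?thesis
    by (rule filterlim_compose)
qed

lemma line_derivative_bound:
  assumes f: "line_derivative i f f'" and "h \<ge> 0"
    and B: "\<And>s. 0 \<le> s \<Longrightarrow> s \<le> h \<Longrightarrow> \<bar>f' (x + s *\<^sub>R axis i 1)\<bar> \<le> B"
  shows "\<bar>f (x + h *\<^sub>R axis i 1) - f x\<bar> \<le> B * h"
proof (cases "h = 0")
  case False
  then obtain z where "0 < z" "z < h"
    "f (x + h *\<^sub>R axis i 1) - f (x + 0 *\<^sub>R axis i 1) = (h - 0) * f' (x + z *\<^sub>R axis i 1)"
    using MVT2[of 0 h "\<lambda>t. f (x + t *\<^sub>R axis i 1)" "\<lambda>t. f' (x + t *\<^sub>R axis i 1)"] f \<open>h \<ge> 0\<close>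
    unfolding line_derivative_def by auto
  then show ?thesis
    using B[of z] \<open>h \<ge> 0\<close> by (simp add: abs_mult mult.commute mult_left_mono)
qed simp

definition diff_quot :: "2 \<Rightarrow> (real^2 \<Rightarrow> real) \<Rightarrow> nat \<Rightarrow> real^2 \<Rightarrow> real" where
  "diff_quot i f n x = real n * (f (x + (1 / real n) *\<^sub>R axis i 1) - f x)"

text \<open>
  A strengthening of the weak derivative for bounded functions: the difference quotients with step
  \<open>1/n\<close> are uniformly bounded and converge almost everywhere. Dominated convergence turns this into a
  weak derivative, and it is inherited by products pointwise; a product rule for weak derivatives
  themselves would need an approximation by smooth functions. Only pairs of points inside \<open>\<Omega>\<close> are
  compared in the bound, since the values outside \<open>\<Omega>\<close> are arbitrary. For \<open>n = 0\<close> the quotient is \<open>0\<close>.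
\<close>
definition bounded_pdiff :: "(real^2) set \<Rightarrow> 2 \<Rightarrow> (real^2 \<Rightarrow> real) \<Rightarrow> (real^2 \<Rightarrow> real) \<Rightarrow> bool" where
  "bounded_pdiff \<Omega> i f g \<longleftrightarrow>
     f \<in> borel_measurable (lebesgue_on \<Omega>) \<and> g \<in> borel_measurable (lebesgue_on \<Omega>) \<and>
     (\<exists>C. AE x in lebesgue_on \<Omega>. \<bar>f x\<bar> \<le> C \<and> \<bar>g x\<bar> \<le> C \<and>
        (\<forall>n. x + (1 / real n) *\<^sub>R axis i 1 \<in> \<Omega> \<longrightarrow> \<bar>diff_quot i f n x\<bar> \<le> C)) \<and>
     (AE x in lebesgue_on \<Omega>. (\<lambda>n. diff_quot i f n x) \<longlonglongrightarrow> g x)"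

lemma bounded_pdiff_bound:
  assumes "bounded_pdiff \<Omega> i f g"
  obtains C where "C \<ge> 0"
    "AE x in lebesgue_on \<Omega>. \<bar>f x\<bar> \<le> C \<and> \<bar>g x\<bar> \<le> C \<and>
        (\<forall>n. x + (1 / real n) *\<^sub>R axis i 1 \<in> \<Omega> \<longrightarrow> \<bar>diff_quot i f n x\<bar> \<le> C)"
proof -
  obtain C where C: "AE x in lebesgue_on \<Omega>. \<bar>f x\<bar> \<le> C \<and> \<bar>g x\<bar> \<le> C \<and>
        (\<forall>n. x + (1 / real n) *\<^sub>R axis i 1 \<in> \<Omega> \<longrightarrow> \<bar>diff_quot i f n x\<bar> \<le> C)"
    using assms unfolding bounded_pdiff_def by blast
  show thesis
  proof (rule that[of "max C 0"])
    show "AE x in lebesgue_on \<Omega>. \<bar>f x\<bar> \<le> max C 0 \<and> \<bar>g x\<bar> \<le> max C 0 \<and>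
        (\<forall>n. x + (1 / real n) *\<^sub>R axis i 1 \<in> \<Omega> \<longrightarrow> \<bar>diff_quot i f n x\<bar> \<le> max C 0)"
      using C by (rule eventually_mono) (auto simp: le_max_iff_disj)
  qed simp
qed

lemma bounded_pdiff_measurable:
  assumes "bounded_pdiff \<Omega> i f g"
  shows "f \<in> borel_measurable (lebesgue_on \<Omega>)" "g \<in> borel_measurable (lebesgue_on \<Omega>)"
  using assms by (auto simp: bounded_pdiff_def)

lemma bounded_pdiff_integrable:
  assumes "bounded_pdiff \<Omega> i f g" "open \<Omega>" "bounded \<Omega>"
  shows "integrable (lebesgue_on \<Omega>) f" "integrable (lebesgue_on \<Omega>) g"
proof -
  obtain C where C: "AE x in lebesgue_on \<Omega>. \<bar>f x\<bar> \<le> C \<and> \<bar>g x\<bar> \<le> C \<and>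
        (\<forall>n. x + (1 / real n) *\<^sub>R axis i 1 \<in> \<Omega> \<longrightarrow> \<bar>diff_quot i f n x\<bar> \<le> C)"
    by (rule bounded_pdiff_bound[OF assms(1)])
  show "integrable (lebesgue_on \<Omega>) f"
    by (rule integrable_bounded[where C = C, OF assms(2,3) bounded_pdiff_measurable(1)[OF assms(1)]])
      (rule eventually_mono[OF C], simp)
  show "integrable (lebesgue_on \<Omega>) g"
    by (rule integrable_bounded[where C = C, OF assms(2,3) bounded_pdiff_measurable(2)[OF assms(1)]])
      (rule eventually_mono[OF C], simp)
qed

text \<open>
  Translation invariance of the integral moves the difference quotient from \<open>f\<close> to the test function,
  with opposite sign of the step. Both sides converge by dominated convergence; a test function vanishes
  near the boundary, so for small steps only points of \<open>\<Omega>\<close> are involved.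
\<close>
lemma bounded_pdiff_imp_weak_pdiff:
  assumes fg: "bounded_pdiff \<Omega> i f g" and \<Omega>: "open \<Omega>" "bounded \<Omega>"
  shows "is_weak_pdiff \<Omega> i f g"
  unfolding is_weak_pdiff_def
proof (intro conjI ballI)
  have \<Omega>_sets[simp]: "\<Omega> \<in> sets lebesgue" using \<Omega> by auto
  have int: "integrable (lebesgue_on \<Omega>) f" "integrable (lebesgue_on \<Omega>) g"
    using bounded_pdiff_integrable[OF fg \<Omega>] .
  show "locally_integrable \<Omega> f" "locally_integrable \<Omega> g"
    using int by (auto intro: integrable_imp_locally_integrable)
  fix \<phi> assume \<phi>: "\<phi> \<in> test_functions \<Omega>"
  let ?e = "axis i 1 :: real^2"
  obtain K B where K: "compact K" "K \<subseteq> \<Omega>" "\<And>x. x \<notin> K \<Longrightarrow> \<phi> x = 0" "\<And>x. \<bar>\<phi> x\<bar> \<le> B" "B > 0"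
    using test_function_support[OF \<phi>] by metis
  obtain B' where B': "\<And>x. \<bar>pdiff i \<phi> x\<bar> \<le> B'"
    using test_function_support[OF pdiff_test_function[OF \<phi>, of i]] by metis
  have line: "line_derivative i \<phi> (pdiff i \<phi>)"
    by (rule line_derivative_pdiff) (rule test_function_differentiable[OF \<phi>])
  have \<phi>_meas: "\<phi> \<in> borel_measurable lebesgue" by (rule test_function_measurable[OF \<phi>])
  obtain C where C: "C \<ge> 0" "AE x in lebesgue_on \<Omega>. \<bar>f x\<bar> \<le> C \<and> \<bar>g x\<bar> \<le> C \<and>
        (\<forall>n. x + (1 / real n) *\<^sub>R ?e \<in> \<Omega> \<longrightarrow> \<bar>diff_quot i f n x\<bar> \<le> C)"
    by (rule bounded_pdiff_bound[OF fg])
  obtain \<delta> where \<delta>: "\<delta> > 0" "(\<Union>x\<in>K. ball x \<delta>) \<subseteq> \<Omega>"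
    using compact_subset_open_imp_ball_epsilon_subset[OF K(1) \<Omega>(1) K(2)] by blast
  \<comment> \<open>Steps \<open>1/n\<close> with \<open>n > n0\<close> do not lead from the support of \<open>\<phi>\<close> out of \<open>\<Omega>\<close>.\<close>
  obtain n0 :: nat where n0: "1 / \<delta> < real n0" using reals_Archimedean2 by blast
  define h where "h n = 1 / real (n + Suc n0)" for n
  have h: "h n > 0" "h n < \<delta>" for n
  proof -
    show "h n > 0" by (simp add: h_def)
    have "1 < \<delta> * real n0" using n0 \<delta>(1) by (simp add: field_simps)
    also have "\<dots> \<le> \<delta> * real (n + Suc n0)" using \<delta>(1) by (intro mult_left_mono) auto
    finally show "h n < \<delta>" by (simp add: h_def field_simps)
  qed
  have h0: "h \<longlonglongrightarrow> 0"
    unfolding h_def using LIMSEQ_ignore_initial_segment[OF lim_1_over_n, of "Suc n0"] by simp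
  define F where "F = (\<lambda>x. indicator \<Omega> x *\<^sub>R f x)"
  have F: "integrable lebesgue F"
    using int(1) unfolding F_def by (subst (asm) integrable_restrict_space) auto
  have F_meas: "F \<in> borel_measurable lebesgue" using F by (rule borel_measurable_integrable)
  have in_\<Omega>: "x + h n *\<^sub>R ?e \<in> \<Omega>" if "x \<in> K" for x n
  proof -
    have "dist x (x + h n *\<^sub>R ?e) < \<delta>"
      using h[of n] by (simp add: dist_norm norm_Basis)
    then show ?thesis using \<delta>(2) that by (meson UN_I mem_ball subsetD)
  qed
  \<comment> \<open>Integration by parts for difference quotients, with \<open>f\<close> extended by zero.\<close>
  have parts: "integral\<^sup>L lebesgue (\<lambda>x. F x * ((\<phi> (- h n *\<^sub>R ?e + x) - \<phi> x) / h n))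
      = integral\<^sup>L lebesgue (\<lambda>x. (F (h n *\<^sub>R ?e + x) - F x) / h n * \<phi> x)" (is "?L = ?R") for n
  proof -
    have shift_meas: "(\<lambda>x. \<phi> (a + x)) \<in> borel_measurable lebesgue" for a
      by (rule lebesgue_integral_translation(2)[OF \<phi>_meas])
    have int_shift: "integrable lebesgue (\<lambda>x. F x * \<phi> (a + x))" for a
    proof (rule Bochner_Integration.integrable_bound)
      show "integrable lebesgue (\<lambda>x. B * F x)" using F by simp
      show "(\<lambda>x. F x * \<phi> (a + x)) \<in> borel_measurable lebesgue"
        by (intro borel_measurable_times F_meas shift_meas)
      show "AE x in lebesgue. norm (F x * \<phi> (a + x)) \<le> norm (B * F x)"
        using K(5) mult_left_mono[OF K(4) abs_ge_zero]
        by (intro AE_I2) (simp add: abs_mult mult.commute[of B])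
    qed
    let ?G = "\<lambda>x. F x * \<phi> (- h n *\<^sub>R ?e + x)"
    have G: "?G \<in> borel_measurable lebesgue"
      using int_shift by (rule borel_measurable_integrable)
    have eq: "(\<lambda>x. ?G (h n *\<^sub>R ?e + x)) = (\<lambda>x. F (h n *\<^sub>R ?e + x) * \<phi> x)"
      by (simp add: algebra_simps)
    have int_F: "integrable lebesgue (\<lambda>x. F (h n *\<^sub>R ?e + x) * \<phi> x)"
      using lebesgue_integral_translation(3)[OF G int_shift, of "h n *\<^sub>R ?e"] unfolding eq .
    have "integral\<^sup>L lebesgue ?G = integral\<^sup>L lebesgue (\<lambda>x. F (h n *\<^sub>R ?e + x) * \<phi> x)"
      using lebesgue_integral_translation(1)[OF G, of "h n *\<^sub>R ?e"] unfolding eq by simp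
    moreover have "?L = (integral\<^sup>L lebesgue ?G - integral\<^sup>L lebesgue (\<lambda>x. F x * \<phi> x)) / h n"
    proof -
      have "?L = integral\<^sup>L lebesgue (\<lambda>x. (?G x - F x * \<phi> (0 + x)) / h n)"
        by (intro Bochner_Integration.integral_cong refl) (simp add: algebra_simps diff_divide_distrib)
      then show ?thesis
        using Bochner_Integration.integral_diff[OF int_shift[of "- h n *\<^sub>R ?e"] int_shift[of 0]] by simp
    qed
    moreover have "?R = (integral\<^sup>L lebesgue (\<lambda>x. F (h n *\<^sub>R ?e + x) * \<phi> x) - integral\<^sup>L lebesgue (\<lambda>x. F x * \<phi> x)) / h n"
    proof -
      have "?R = integral\<^sup>L lebesgue (\<lambda>x. (F (h n *\<^sub>R ?e + x) * \<phi> x - F x * \<phi> (0 + x)) / h n)"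
        by (intro Bochner_Integration.integral_cong refl) (simp add: algebra_simps diff_divide_distrib)
      then show ?thesis
        using Bochner_Integration.integral_diff[OF int_F int_shift[of 0]] by simp
    qed
    ultimately show ?thesis by (simp only:)
  qed
  have "(\<lambda>n. integral\<^sup>L lebesgue (\<lambda>x. F x * ((\<phi> (- h n *\<^sub>R ?e + x) - \<phi> x) / h n)))
      \<longlonglongrightarrow> integral\<^sup>L lebesgue (\<lambda>x. F x * - pdiff i \<phi> x)"
  proof (rule integral_dominated_convergence)
    show "integrable lebesgue (\<lambda>x. \<bar>F x\<bar> * B')" using F by simp
    show "(\<lambda>x. F x * - pdiff i \<phi> x) \<in> borel_measurable lebesgue"
      by (intro borel_measurable_times F_meas borel_measurable_uminus
          test_function_measurable[OF pdiff_test_function[OF \<phi>]])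
    show "(\<lambda>x. F x * ((\<phi> (- h n *\<^sub>R ?e + x) - \<phi> x) / h n)) \<in> borel_measurable lebesgue" for n
      by (intro borel_measurable_times F_meas borel_measurable_divide borel_measurable_diff \<phi>_meas
          lebesgue_integral_translation(2)[OF \<phi>_meas] borel_measurable_const)
    show "AE x in lebesgue. (\<lambda>n. F x * ((\<phi> (- h n *\<^sub>R ?e + x) - \<phi> x) / h n)) \<longlonglongrightarrow> F x * - pdiff i \<phi> x"
    proof (intro AE_I2 tendsto_mult tendsto_const)
      fix x
      have "(\<lambda>n. (\<phi> (x + (- h n) *\<^sub>R ?e) - \<phi> x) / (- h n)) \<longlonglongrightarrow> pdiff i \<phi> x"
      proof (rule line_derivative_quotient_tendsto[OF line])
        show "(\<lambda>n. - h n) \<longlonglongrightarrow> 0" using tendsto_minus[OF h0] by simp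
        show "- h n \<noteq> 0" for n using h(1)[of n] by simp
      qed
      from tendsto_minus[OF this]
      show "(\<lambda>n. (\<phi> (- h n *\<^sub>R ?e + x) - \<phi> x) / h n) \<longlonglongrightarrow> - pdiff i \<phi> x"
        by (simp add: add.commute)
    qed
    show "AE x in lebesgue. norm (F x * ((\<phi> (- h n *\<^sub>R ?e + x) - \<phi> x) / h n)) \<le> \<bar>F x\<bar> * B'" for n
    proof (intro AE_I2)
      fix x
      have "\<bar>\<phi> (x - h n *\<^sub>R ?e + h n *\<^sub>R ?e) - \<phi> (x - h n *\<^sub>R ?e)\<bar> \<le> B' * h n"
        using h[of n] B' by (intro line_derivative_bound[OF line]) auto
      then have "\<bar>\<phi> (- h n *\<^sub>R ?e + x) - \<phi> x\<bar> / h n \<le> B'"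
        using h[of n] by (simp add: abs_minus_commute pos_divide_le_eq)
      then show "norm (F x * ((\<phi> (- h n *\<^sub>R ?e + x) - \<phi> x) / h n)) \<le> \<bar>F x\<bar> * B'"
        using h[of n] mult_left_mono[of "\<bar>\<phi> (- h n *\<^sub>R ?e + x) - \<phi> x\<bar> / h n" B' "\<bar>F x\<bar>"]
        by (simp add: abs_mult abs_divide)
    qed
  qed
  moreover have "(\<lambda>n. integral\<^sup>L lebesgue (\<lambda>x. (F (h n *\<^sub>R ?e + x) - F x) / h n * \<phi> x))
      \<longlonglongrightarrow> integral\<^sup>L lebesgue (\<lambda>x. indicator \<Omega> x *\<^sub>R g x * \<phi> x)"
  proof (rule integral_dominated_convergence)
    have g_meas: "(\<lambda>x. indicator \<Omega> x *\<^sub>R g x) \<in> borel_measurable lebesgue"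
      using int(2) by (intro borel_measurable_integrable) (subst (asm) integrable_restrict_space, auto)
    show "integrable lebesgue (\<lambda>x. C * B * indicator K x)"
      using emeasure_compact_finite[OF K(1)] K(1)
      by (intro integrable_mult_right integrable_real_indicator) (auto simp: compact_imp_closed)
    show "(\<lambda>x. indicator \<Omega> x *\<^sub>R g x * \<phi> x) \<in> borel_measurable lebesgue"
      by (intro borel_measurable_times g_meas \<phi>_meas)
    show "(\<lambda>x. (F (h n *\<^sub>R ?e + x) - F x) / h n * \<phi> x) \<in> borel_measurable lebesgue" for n
      by (intro borel_measurable_times F_meas borel_measurable_divide borel_measurable_diff \<phi>_meas
          lebesgue_integral_translation(2)[OF F_meas] borel_measurable_const)
    have quot: "(F (h n *\<^sub>R ?e + x) - F x) / h n = diff_quot i f (n + Suc n0) x" if "x \<in> K" for x n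
      using that in_\<Omega>[of x n] K(2)
      by (auto simp: F_def diff_quot_def h_def indicator_def add.commute)
    have conv: "AE x in lebesgue. x \<in> \<Omega> \<longrightarrow> (\<lambda>n. diff_quot i f n x) \<longlonglongrightarrow> g x"
      using fg unfolding bounded_pdiff_def by (subst (asm) (2) AE_restrict_space_iff) auto
    show "AE x in lebesgue. (\<lambda>n. (F (h n *\<^sub>R ?e + x) - F x) / h n * \<phi> x) \<longlonglongrightarrow> indicator \<Omega> x *\<^sub>R g x * \<phi> x"
      using conv
    proof (rule eventually_mono)
      fix x assume x: "x \<in> \<Omega> \<longrightarrow> (\<lambda>n. diff_quot i f n x) \<longlonglongrightarrow> g x"
      show "(\<lambda>n. (F (h n *\<^sub>R ?e + x) - F x) / h n * \<phi> x) \<longlonglongrightarrow> indicator \<Omega> x *\<^sub>R g x * \<phi> x"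
      proof (cases "x \<in> K")
        case True
        then have "(\<lambda>n. diff_quot i f (n + Suc n0) x) \<longlonglongrightarrow> g x"
          using x K(2) by (intro LIMSEQ_ignore_initial_segment) auto
        then have "(\<lambda>n. diff_quot i f (n + Suc n0) x * \<phi> x) \<longlonglongrightarrow> g x * \<phi> x"
          by (rule tendsto_mult) (rule tendsto_const)
        then show ?thesis
          unfolding quot[OF True] using True K(2) by (auto simp: indicator_def)
      qed (simp add: K(3))
    qed
    have bd: "AE x in lebesgue. x \<in> \<Omega> \<longrightarrow> (\<forall>n. x + (1 / real n) *\<^sub>R ?e \<in> \<Omega> \<longrightarrow> \<bar>diff_quot i f n x\<bar> \<le> C)"
      using C(2) by (subst (asm) AE_restrict_space_iff) (auto elim!: eventually_mono)
    show "AE x in lebesgue. norm ((F (h n *\<^sub>R ?e + x) - F x) / h n * \<phi> x) \<le> C * B * indicator K x" for n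
      using bd
    proof (rule eventually_mono)
      fix x assume x: "x \<in> \<Omega> \<longrightarrow> (\<forall>n. x + (1 / real n) *\<^sub>R ?e \<in> \<Omega> \<longrightarrow> \<bar>diff_quot i f n x\<bar> \<le> C)"
      show "norm ((F (h n *\<^sub>R ?e + x) - F x) / h n * \<phi> x) \<le> C * B * indicator K x"
      proof (cases "x \<in> K")
        case True
        then have "\<bar>diff_quot i f (n + Suc n0) x\<bar> \<le> C"
          using x in_\<Omega>[of x n] K(2) by (auto simp: h_def)
        then show ?thesis
          unfolding quot[OF True] using True C(1) K(4)[of x]
          by (auto simp: abs_mult intro!: mult_mono)
      qed (simp add: K(3))
    qed
  qed
  ultimately have "integral\<^sup>L lebesgue (\<lambda>x. F x * - pdiff i \<phi> x) = integral\<^sup>L lebesgue (\<lambda>x. indicator \<Omega> x *\<^sub>R g x * \<phi> x)"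
    unfolding parts by (rule LIMSEQ_unique)
  then show "L2_inner \<Omega> f (pdiff i \<phi>) = - L2_inner \<Omega> g \<phi>"
    by (simp add: L2_inner_def integral_restrict_space F_def mult.assoc)
qed

lemma bounded_pdiff_imp_weak_pdiff_eq:
  assumes "bounded_pdiff \<Omega> i f g" "open \<Omega>" "bounded \<Omega>"
  shows "AE x in lebesgue_on \<Omega>. weak_pdiff \<Omega> i f x = g x"
proof -
  have w: "is_weak_pdiff \<Omega> i f g"
    by (rule bounded_pdiff_imp_weak_pdiff[OF assms])
  then have "is_weak_pdiff \<Omega> i f (weak_pdiff \<Omega> i f)"
    unfolding weak_pdiff_def by (rule someI[of "is_weak_pdiff \<Omega> i f"])
  from weak_pdiff_unique[OF assms(2) this w] show ?thesis .
qed

lemma bounded_pdiff_add: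
  assumes 1: "bounded_pdiff \<Omega> i f1 g1" and 2: "bounded_pdiff \<Omega> i f2 g2"
  shows "bounded_pdiff \<Omega> i (\<lambda>x. f1 x + f2 x) (\<lambda>x. g1 x + g2 x)"
proof -
  obtain C1 where C1: "AE x in lebesgue_on \<Omega>. \<bar>f1 x\<bar> \<le> C1 \<and> \<bar>g1 x\<bar> \<le> C1 \<and>
      (\<forall>n. x + (1 / real n) *\<^sub>R axis i 1 \<in> \<Omega> \<longrightarrow> \<bar>diff_quot i f1 n x\<bar> \<le> C1)"
    by (rule bounded_pdiff_bound[OF 1])
  obtain C2 where C2: "AE x in lebesgue_on \<Omega>. \<bar>f2 x\<bar> \<le> C2 \<and> \<bar>g2 x\<bar> \<le> C2 \<and>
      (\<forall>n. x + (1 / real n) *\<^sub>R axis i 1 \<in> \<Omega> \<longrightarrow> \<bar>diff_quot i f2 n x\<bar> \<le> C2)"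
    by (rule bounded_pdiff_bound[OF 2])
  have eq: "diff_quot i (\<lambda>x. f1 x + f2 x) n x = diff_quot i f1 n x + diff_quot i f2 n x" for n x
    by (simp add: diff_quot_def algebra_simps)
  have tri: "\<bar>a\<bar> \<le> C1 \<Longrightarrow> \<bar>b\<bar> \<le> C2 \<Longrightarrow> \<bar>a + b\<bar> \<le> C1 + C2" for a b :: real
    by linarith
  show ?thesis
    unfolding bounded_pdiff_def eq
  proof (intro conjI)
    show "\<exists>C. AE x in lebesgue_on \<Omega>. \<bar>f1 x + f2 x\<bar> \<le> C \<and> \<bar>g1 x + g2 x\<bar> \<le> C \<and>
      (\<forall>n. x + (1 / real n) *\<^sub>R axis i 1 \<in> \<Omega> \<longrightarrow> \<bar>diff_quot i f1 n x + diff_quot i f2 n x\<bar> \<le> C)"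
    proof (rule exI[of _ "C1 + C2"])
      show "AE x in lebesgue_on \<Omega>. \<bar>f1 x + f2 x\<bar> \<le> C1 + C2 \<and> \<bar>g1 x + g2 x\<bar> \<le> C1 + C2 \<and>
        (\<forall>n. x + (1 / real n) *\<^sub>R axis i 1 \<in> \<Omega> \<longrightarrow> \<bar>diff_quot i f1 n x + diff_quot i f2 n x\<bar> \<le> C1 + C2)"
        using C1 C2 by eventually_elim (use tri in blast)
    qed
    have "AE x in lebesgue_on \<Omega>. (\<lambda>n. diff_quot i f1 n x) \<longlonglongrightarrow> g1 x"
      "AE x in lebesgue_on \<Omega>. (\<lambda>n. diff_quot i f2 n x) \<longlonglongrightarrow> g2 x"
      using 1 2 by (auto simp: bounded_pdiff_def)
    then show "AE x in lebesgue_on \<Omega>. (\<lambda>n. diff_quot i f1 n x + diff_quot i f2 n x) \<longlonglongrightarrow> g1 x + g2 x"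
      by eventually_elim (rule tendsto_add)
  qed (use 1 2 in \<open>auto intro!: borel_measurable_add dest: bounded_pdiff_measurable\<close>)
qed

text \<open>
  The product rule holds already for difference quotients, up to a shift by \<open>e\<^sub>i/n\<close> in the argument of
  one factor, which disappears in the limit.
\<close>
lemma bounded_pdiff_mult:
  assumes 1: "bounded_pdiff \<Omega> i f1 g1" and 2: "bounded_pdiff \<Omega> i f2 g2"
  shows "bounded_pdiff \<Omega> i (\<lambda>x. f1 x * f2 x) (\<lambda>x. g1 x * f2 x + f1 x * g2 x)"
proof -
  let ?y = "\<lambda>n x. x + (1 / real n) *\<^sub>R axis i 1 :: real^2"
  obtain C1 where C1: "C1 \<ge> 0" "AE x in lebesgue_on \<Omega>. \<bar>f1 x\<bar> \<le> C1 \<and> \<bar>g1 x\<bar> \<le> C1 \<and>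
      (\<forall>n. ?y n x \<in> \<Omega> \<longrightarrow> \<bar>diff_quot i f1 n x\<bar> \<le> C1)"
    by (rule bounded_pdiff_bound[OF 1])
  obtain C2 where C2: "C2 \<ge> 0" "AE x in lebesgue_on \<Omega>. \<bar>f2 x\<bar> \<le> C2 \<and> \<bar>g2 x\<bar> \<le> C2 \<and>
      (\<forall>n. ?y n x \<in> \<Omega> \<longrightarrow> \<bar>diff_quot i f2 n x\<bar> \<le> C2)"
    by (rule bounded_pdiff_bound[OF 2])
  have lim1: "AE x in lebesgue_on \<Omega>. (\<lambda>n. diff_quot i f1 n x) \<longlonglongrightarrow> g1 x"
    and lim2: "AE x in lebesgue_on \<Omega>. (\<lambda>n. diff_quot i f2 n x) \<longlonglongrightarrow> g2 x"
    using 1 2 by (auto simp: bounded_pdiff_def)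
  have eq: "diff_quot i (\<lambda>x. f1 x * f2 x) n x = diff_quot i f1 n x * f2 (?y n x) + f1 x * diff_quot i f2 n x" for n x
    by (simp add: diff_quot_def algebra_simps)
  \<comment> \<open>For \<open>n = 0\<close> both sides are \<open>f2 x\<close>, because \<open>1 / 0 = 0\<close>.\<close>
  have shift: "f2 (?y n x) = f2 x + (1 / real n) * diff_quot i f2 n x" for n x
    by (cases "n = 0") (simp_all add: diff_quot_def)
  show ?thesis
    unfolding bounded_pdiff_def eq
  proof (intro conjI)
    show "\<exists>C. AE x in lebesgue_on \<Omega>. \<bar>f1 x * f2 x\<bar> \<le> C \<and> \<bar>g1 x * f2 x + f1 x * g2 x\<bar> \<le> C \<and>
      (\<forall>n. ?y n x \<in> \<Omega> \<longrightarrow> \<bar>diff_quot i f1 n x * f2 (?y n x) + f1 x * diff_quot i f2 n x\<bar> \<le> C)"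
    proof (intro exI[of _ "3 * C1 * C2"])
      have prod: "\<bar>a * b\<bar> \<le> A * B" if "\<bar>a\<bar> \<le> A" "\<bar>b\<bar> \<le> B" for a b A B :: real
        using that by (auto simp: abs_mult intro!: mult_mono)
      show "AE x in lebesgue_on \<Omega>. \<bar>f1 x * f2 x\<bar> \<le> 3 * C1 * C2 \<and> \<bar>g1 x * f2 x + f1 x * g2 x\<bar> \<le> 3 * C1 * C2 \<and>
        (\<forall>n. ?y n x \<in> \<Omega> \<longrightarrow> \<bar>diff_quot i f1 n x * f2 (?y n x) + f1 x * diff_quot i f2 n x\<bar> \<le> 3 * C1 * C2)"
        using C1(2) C2(2)
      proof eventually_elim
        case (elim x)
        have nonneg: "0 \<le> C1 * C2" using C1(1) C2(1) by simp
        have a: "\<bar>f1 x * f2 x\<bar> \<le> C1 * C2" "\<bar>g1 x * f2 x\<bar> \<le> C1 * C2" "\<bar>f1 x * g2 x\<bar> \<le> C1 * C2"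
          using elim prod by auto
        have b: "\<bar>diff_quot i f1 n x * f2 (?y n x) + f1 x * diff_quot i f2 n x\<bar> \<le> 3 * C1 * C2"
          if "?y n x \<in> \<Omega>" for n
        proof -
          have "\<bar>(1 / real n) * diff_quot i f2 n x\<bar> \<le> 1 * C2"
            using elim that by (intro prod) (auto simp: divide_le_eq)
          then have "\<bar>f2 (?y n x)\<bar> \<le> 2 * C2"
            using elim unfolding shift by linarith
          then have "\<bar>diff_quot i f1 n x * f2 (?y n x)\<bar> \<le> C1 * (2 * C2)"
            using elim that by (intro prod) auto
          moreover have "\<bar>f1 x * diff_quot i f2 n x\<bar> \<le> C1 * C2"
            using elim that by (intro prod) auto
          ultimately show ?thesis by linarith
        qed
        show ?case using a b nonneg by auto
      qed
    qed
    show "AE x in lebesgue_on \<Omega>. (\<lambda>n. diff_quot i f1 n x * f2 (?y n x) + f1 x * diff_quot i f2 n x)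
        \<longlonglongrightarrow> g1 x * f2 x + f1 x * g2 x"
      using lim1 lim2
    proof eventually_elim
      case (elim x)
      have "(\<lambda>n. f2 (?y n x)) \<longlonglongrightarrow> f2 x + 0 * g2 x"
        unfolding shift by (intro tendsto_intros elim lim_1_over_n)
      then have "(\<lambda>n. f2 (?y n x)) \<longlonglongrightarrow> f2 x" by simp
      then show ?case by (intro tendsto_intros elim)
    qed
  qed (use 1 2 in \<open>auto intro!: borel_measurable_add borel_measurable_times dest: bounded_pdiff_measurable\<close>)
qed

lemma bounded_pdiff_const:
  "bounded_pdiff \<Omega> i (\<lambda>x. c) (\<lambda>x. 0)"
  by (auto simp: bounded_pdiff_def diff_quot_def intro!: exI[of _ "\<bar>c\<bar>"])

lemma bounded_pdiff_cmult:
  assumes "bounded_pdiff \<Omega> i f g"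
  shows "bounded_pdiff \<Omega> i (\<lambda>x. c * f x) (\<lambda>x. c * g x)"
  using bounded_pdiff_mult[OF bounded_pdiff_const[of \<Omega> i c] assms] by simp

lemma bounded_pdiff_C1:
  assumes p: "line_derivative i p p'" "continuous_on UNIV p" "continuous_on UNIV p'"
    and U: "open U" "bounded U" "convex U"
  shows "bounded_pdiff U i p p'"
proof -
  have U_sets: "U \<in> sets lebesgue" using U by auto
  have cl: "compact (closure U)" using U by (simp add: compact_closure)
  have bd: "\<exists>C. \<forall>x\<in>U. \<bar>q x\<bar> \<le> C" if "continuous_on UNIV q" for q :: "real^2 \<Rightarrow> real"
  proof -
    have "bounded (q ` closure U)"
      using cl that by (intro compact_imp_bounded compact_continuous_image) (auto intro: continuous_on_subset)
    then obtain C where "\<forall>y\<in>q ` closure U. norm y \<le> C"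
      unfolding bounded_iff by blast
    then show ?thesis using closure_subset[of U] by (intro exI[of _ C]) auto
  qed
  obtain C1 where C1: "\<And>x. x \<in> U \<Longrightarrow> \<bar>p x\<bar> \<le> C1" using bd[OF p(2)] by blast
  obtain C2 where C2: "\<And>x. x \<in> U \<Longrightarrow> \<bar>p' x\<bar> \<le> C2" using bd[OF p(3)] by blast
  have meas: "q \<in> borel_measurable (lebesgue_on U)" if "continuous_on UNIV q" for q :: "real^2 \<Rightarrow> real"
    using that U_sets by (intro continuous_imp_measurable_on_sets_lebesgue) (auto intro: continuous_on_subset)
  show ?thesis
    unfolding bounded_pdiff_def
  proof (intro conjI exI[of _ "max C1 C2"] meas p(2,3))
    have "\<bar>diff_quot i p n x\<bar> \<le> C2" if x: "x \<in> U" and y: "x + (1 / real n) *\<^sub>R axis i 1 \<in> U" for x n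
    proof (cases "n = 0")
      case True
      then show ?thesis using C2[OF x] by (simp add: diff_quot_def)
    next
      case False
      have "\<bar>p (x + (1 / real n) *\<^sub>R axis i 1) - p x\<bar> \<le> C2 * (1 / real n)"
      proof (rule line_derivative_bound[OF p(1)])
        fix s :: real assume s: "0 \<le> s" "s \<le> 1 / real n"
        have "x + s *\<^sub>R axis i 1 \<in> closed_segment x (x + (1 / real n) *\<^sub>R axis i 1)"
          using s False unfolding closed_segment_def
          by (intro CollectI exI[of _ "s * real n"]) (auto simp: algebra_simps field_simps)
        then have "x + s *\<^sub>R axis i 1 \<in> U"
          using closed_segment_subset[OF x y U(3)] by blast
        then show "\<bar>p' (x + s *\<^sub>R axis i 1)\<bar> \<le> C2" by (rule C2)
      qed simp
      then show ?thesis
        using False by (simp add: diff_quot_def abs_mult pos_le_divide_eq mult.commute)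
    qed
    then show "AE x in lebesgue_on U. \<bar>p x\<bar> \<le> max C1 C2 \<and> \<bar>p' x\<bar> \<le> max C1 C2 \<and>
        (\<forall>n. x + (1 / real n) *\<^sub>R axis i 1 \<in> U \<longrightarrow> \<bar>diff_quot i p n x\<bar> \<le> max C1 C2)"
      using C1 C2 by (intro AE_I2) (auto simp: le_max_iff_disj)
    show "AE x in lebesgue_on U. (\<lambda>n. diff_quot i p n x) \<longlonglongrightarrow> p' x"
    proof (intro AE_I2)
      fix x
      have "(\<lambda>n. (p (x + (1 / real (Suc n)) *\<^sub>R axis i 1) - p x) / (1 / real (Suc n))) \<longlonglongrightarrow> p' x"
        using LIMSEQ_Suc[OF lim_1_over_n] by (intro line_derivative_quotient_tendsto[OF p(1)]) simp_all
      then have "(\<lambda>n. diff_quot i p (Suc n) x) \<longlonglongrightarrow> p' x"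
        by (simp add: diff_quot_def mult.commute)
      then show "(\<lambda>n. diff_quot i p n x) \<longlonglongrightarrow> p' x"
        by (rule LIMSEQ_imp_Suc)
    qed
  qed
qed

section \<open>Finite element functions\<close>
lemma poly2_fun_line_derivative:
  assumes "poly2_fun r p"
  obtains p' where "line_derivative i p p'" "continuous_on UNIV p" "continuous_on UNIV p'"
proof -
  obtain c :: "nat \<Rightarrow> nat \<Rightarrow> real" where "\<forall>x. p x = (\<Sum>k\<le>r. \<Sum>j\<le>r - k. c k j * (x$1) ^ k * (x$2) ^ j)"
    using assms unfolding poly2_fun_def by blast
  then have p: "p = (\<lambda>x. \<Sum>k\<le>r. \<Sum>j\<le>r - k. c k j * (x$1) ^ k * (x$2) ^ j)"
    by (intro ext) simp
  let ?e = "axis i 1 :: real^2"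
  define p' where "p' x = (\<Sum>k\<le>r. \<Sum>j\<le>r - k. c k j *
      (real k * (x$1) ^ (k - 1) * ?e$1 * (x$2) ^ j + (x$1) ^ k * (real j * (x$2) ^ (j - 1) * ?e$2)))" for x :: "real^2"
  show thesis
  proof
    have comp: "((\<lambda>t. (x + t *\<^sub>R ?e) $ l ^ k) has_real_derivative
        real k * (x + t *\<^sub>R ?e) $ l ^ (k - 1) * ?e $ l) (at t)" for x :: "real^2" and l k t
    proof -
      have "((\<lambda>t. x $ l + t * ?e $ l) has_real_derivative ?e $ l) (at t)"
        by (auto intro!: derivative_eq_intros)
      from DERIV_power[OF this, of k] show ?thesis
        by (simp add: mult.commute mult.left_commute)
    qed
    show "line_derivative i p p'"
      unfolding line_derivative_def p p'_def
    proof (intro allI DERIV_sum)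
      fix x :: "real^2" and t k j
      let ?y = "x + t *\<^sub>R ?e"
      have "((\<lambda>t. c k j * ((x + t *\<^sub>R ?e) $ 1 ^ k * (x + t *\<^sub>R ?e) $ 2 ^ j)) has_real_derivative
          c k j * ((real k * ?y $ 1 ^ (k - 1) * ?e $ 1) * ?y $ 2 ^ j
            + (real j * ?y $ 2 ^ (j - 1) * ?e $ 2) * ?y $ 1 ^ k)) (at t)"
        by (rule DERIV_cmult[OF DERIV_mult[OF comp comp]])
      then show "((\<lambda>t. c k j * (x + t *\<^sub>R ?e) $ 1 ^ k * (x + t *\<^sub>R ?e) $ 2 ^ j) has_real_derivative
          c k j * (real k * ?y $ 1 ^ (k - 1) * ?e $ 1 * ?y $ 2 ^ j
            + ?y $ 1 ^ k * (real j * ?y $ 2 ^ (j - 1) * ?e $ 2))) (at t)"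
        by (simp only: mult.assoc mult.commute[of "?y $ 1 ^ k"])
    qed
    show "continuous_on UNIV p" "continuous_on UNIV p'"
      unfolding p p'_def[abs_def] by (intro continuous_intros)+
  qed
qed

lemma L2_inner_test_function_subset:
  assumes "\<phi> \<in> test_functions U" "U \<subseteq> \<Omega>" "U \<in> sets lebesgue" "\<Omega> \<in> sets lebesgue"
  shows "L2_inner \<Omega> f \<phi> = L2_inner U f \<phi>"
proof -
  obtain K B where K: "compact K" "K \<subseteq> U" "\<And>x. x \<notin> K \<Longrightarrow> \<phi> x = 0" "\<And>x. \<bar>\<phi> x\<bar> \<le> B" "B > 0"
    using test_function_support[OF assms(1)] by metis
  have "(\<lambda>x. indicator \<Omega> x *\<^sub>R (f x * \<phi> x)) = (\<lambda>x. indicator U x *\<^sub>R (f x * \<phi> x))"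
  proof (rule ext)
    fix x show "indicator \<Omega> x *\<^sub>R (f x * \<phi> x) = indicator U x *\<^sub>R (f x * \<phi> x)"
      using K(2) K(3)[of x] assms(2) by (cases "x \<in> K") (auto simp: indicator_def)
  qed
  then show ?thesis
    using assms(3,4) by (simp add: L2_inner_def integral_restrict_space)
qed

lemma test_functions_mono: "U \<subseteq> \<Omega> \<Longrightarrow> test_functions U \<subseteq> test_functions \<Omega>"
  unfolding test_functions_def by blast

lemma is_weak_pdiff_subset:
  assumes fg: "is_weak_pdiff \<Omega> i f g" and U: "U \<subseteq> \<Omega>" "U \<in> sets lebesgue" "\<Omega> \<in> sets lebesgue"
  shows "is_weak_pdiff U i f g"
  unfolding is_weak_pdiff_def
proof (intro conjI ballI)
  show "locally_integrable U f" "locally_integrable U g"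
    using fg U(1) unfolding is_weak_pdiff_def locally_integrable_def by blast+
  fix \<phi> assume \<phi>: "\<phi> \<in> test_functions U"
  then have "\<phi> \<in> test_functions \<Omega>"
    using test_functions_mono[OF U(1)] by blast
  then have "L2_inner \<Omega> f (pdiff i \<phi>) = - L2_inner \<Omega> g \<phi>"
    using fg unfolding is_weak_pdiff_def by blast
  then show "L2_inner U f (pdiff i \<phi>) = - L2_inner U g \<phi>"
    using L2_inner_test_function_subset[OF \<phi> U] L2_inner_test_function_subset[OF pdiff_test_function[OF \<phi>] U]
    by simp
qed

lemma is_weak_pdiff_cong_AE:
  assumes fg: "is_weak_pdiff \<Omega> i f g" and f': "locally_integrable \<Omega> f'"
    and eq: "AE x in lebesgue_on \<Omega>. f x = f' x" and \<Omega>: "\<Omega> \<in> sets lebesgue"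
  shows "is_weak_pdiff \<Omega> i f' g"
  unfolding is_weak_pdiff_def
proof (intro conjI ballI f')
  show "locally_integrable \<Omega> g" using fg by (simp add: is_weak_pdiff_def)
  fix \<phi> assume \<phi>: "\<phi> \<in> test_functions \<Omega>"
  have f: "locally_integrable \<Omega> f" using fg by (simp add: is_weak_pdiff_def)
  have "L2_inner \<Omega> f' (pdiff i \<phi>) = L2_inner \<Omega> f (pdiff i \<phi>)"
    unfolding L2_inner_def inner_real_def
  proof (rule integral_cong_AE)
    show "(\<lambda>x. f' x * pdiff i \<phi> x) \<in> borel_measurable (lebesgue_on \<Omega>)"
      "(\<lambda>x. f x * pdiff i \<phi> x) \<in> borel_measurable (lebesgue_on \<Omega>)"
      by (intro borel_measurable_integrable locally_integrable_times_test_function f f'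
          pdiff_test_function \<phi> \<Omega>)+
    show "AE x in lebesgue_on \<Omega>. f' x * pdiff i \<phi> x = f x * pdiff i \<phi> x"
      using eq by (rule eventually_mono) simp
  qed
  then show "L2_inner \<Omega> f' (pdiff i \<phi>) = - L2_inner \<Omega> g \<phi>"
    using fg \<phi> by (simp add: is_weak_pdiff_def)
qed

lemma borel_measurable_lebesgue_on_AE:
  fixes f g :: "real^2 \<Rightarrow> real"
  assumes f: "f \<in> borel_measurable (lebesgue_on \<Omega>)" and eq: "AE x in lebesgue_on \<Omega>. f x = g x"
    and \<Omega>: "\<Omega> \<in> sets lebesgue"
  shows "g \<in> borel_measurable (lebesgue_on \<Omega>)"
proof -
  have "AE x in lebesgue. x \<in> \<Omega> \<longrightarrow> f x = g x"
    using eq \<Omega> by (subst (asm) AE_restrict_space_iff) auto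
  then have "AE x in lebesgue. indicator \<Omega> x *\<^sub>R f x = indicator \<Omega> x *\<^sub>R g x"
    by (rule eventually_mono) (auto simp: indicator_def)
  moreover have "(\<lambda>x. indicator \<Omega> x *\<^sub>R f x) \<in> borel_measurable lebesgue"
    using f \<Omega> by (subst (asm) borel_measurable_restrict_space_iff) auto
  ultimately have "(\<lambda>x. indicator \<Omega> x *\<^sub>R g x) \<in> borel_measurable lebesgue"
    by (rule borel_measurable_AE[rotated])
  then show ?thesis
    using \<Omega> by (subst borel_measurable_restrict_space_iff) auto
qed

lemma bounded_pdiff_cong_AE:
  assumes fg: "bounded_pdiff \<Omega> i f g" and eq: "AE x in lebesgue_on \<Omega>. g x = g' x"
    and \<Omega>: "\<Omega> \<in> sets lebesgue"
  shows "bounded_pdiff \<Omega> i f g'"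
proof -
  obtain C where C: "AE x in lebesgue_on \<Omega>. \<bar>f x\<bar> \<le> C \<and> \<bar>g x\<bar> \<le> C \<and>
      (\<forall>n. x + (1 / real n) *\<^sub>R axis i 1 \<in> \<Omega> \<longrightarrow> \<bar>diff_quot i f n x\<bar> \<le> C)"
    using bounded_pdiff_bound[OF fg] by blast
  have lim: "AE x in lebesgue_on \<Omega>. (\<lambda>n. diff_quot i f n x) \<longlonglongrightarrow> g x"
    using fg by (simp add: bounded_pdiff_def)
  show ?thesis
    unfolding bounded_pdiff_def
  proof (intro conjI exI[of _ C])
    show "f \<in> borel_measurable (lebesgue_on \<Omega>)"
      by (rule bounded_pdiff_measurable(1)[OF fg])
    show "g' \<in> borel_measurable (lebesgue_on \<Omega>)"
      by (rule borel_measurable_lebesgue_on_AE[OF bounded_pdiff_measurable(2)[OF fg] eq \<Omega>])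
    show "AE x in lebesgue_on \<Omega>. \<bar>f x\<bar> \<le> C \<and> \<bar>g' x\<bar> \<le> C \<and>
      (\<forall>n. x + (1 / real n) *\<^sub>R axis i 1 \<in> \<Omega> \<longrightarrow> \<bar>diff_quot i f n x\<bar> \<le> C)"
      using C eq by eventually_elim auto
    show "AE x in lebesgue_on \<Omega>. (\<lambda>n. diff_quot i f n x) \<longlonglongrightarrow> g' x"
      using lim eq by eventually_elim simp
  qed
qed

lemma bounded_pdiff_weak_pdiff:
  assumes "bounded_pdiff \<Omega> i f g" "open \<Omega>" "bounded \<Omega>"
  shows "bounded_pdiff \<Omega> i f (weak_pdiff \<Omega> i f)"
proof (rule bounded_pdiff_cong_AE[OF assms(1)])
  show "AE x in lebesgue_on \<Omega>. g x = weak_pdiff \<Omega> i f x"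
    using bounded_pdiff_imp_weak_pdiff_eq[OF assms] by (rule eventually_mono) simp
  show "\<Omega> \<in> sets lebesgue" using assms(2) by simp
qed

text \<open>
  Inside each triangle \<open>f\<close> agrees almost everywhere with a polynomial, so uniqueness on the open
  triangle identifies the weak derivative with that of the polynomial there. The triangles cover \<open>\<Omega>\<close> up
  to their frontiers, which are null sets; hence the weak derivative is bounded, \<open>f\<close> is Lipschitz along
  lines, and the difference quotients converge at almost every point. The Lipschitz bound is where the
  membership in \<open>H1 \<Omega>\<close> excludes jumps between triangles.
\<close>
lemma FE_M_bounded_pdiff:
  assumes domain: "convex_polygonal_domain \<Omega>" and mesh: "triangle_mesh \<Omega> \<T>" and f: "f \<in> FE_M \<Omega> \<T> r"
  shows "bounded_pdiff \<Omega> i f (weak_pdiff \<Omega> i f)"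
proof -
  have \<Omega>: "open \<Omega>" "bounded \<Omega>" "convex \<Omega>"
    using domain by (auto simp: convex_polygonal_domain_def)
  have \<Omega>_sets: "\<Omega> \<in> sets lebesgue" using \<Omega> by auto
  have fin: "finite \<T>" and simplex: "\<And>S. S \<in> \<T> \<Longrightarrow> 2 simplex S" and cover: "\<Union>\<T> = closure \<Omega>"
    using mesh by (auto simp: triangle_mesh_def triangulation_def)
  have S: "compact S" "convex S" if "S \<in> \<T>" for S
    using simplex_imp_polytope[OF simplex[OF that]] polytope_imp_compact polytope_imp_convex by auto
  have int_sub: "interior S \<subseteq> \<Omega>" if "S \<in> \<T>" for S
  proof -
    have "interior S \<subseteq> interior (closure \<Omega>)"
      using cover that by (intro interior_mono) auto
    then show ?thesis
      using convex_interior_closure[OF \<Omega>(3)] interior_open[OF \<Omega>(1)] by simp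
  qed
  let ?e = "axis i 1 :: real^2"
  define g where "g = weak_pdiff \<Omega> i f"
  have fH1: "f \<in> H1 \<Omega>" and pw: "piecewise_poly \<T> r f"
    using f by (auto simp: FE_M_def)
  obtain g0 where g0: "g0 \<in> L2_space \<Omega>" "is_weak_pdiff \<Omega> i f g0"
    using fH1 unfolding H1_def by blast
  have g: "is_weak_pdiff \<Omega> i f g"
    unfolding g_def weak_pdiff_def using g0(2) by (rule someI[of "is_weak_pdiff \<Omega> i f"])
  have f_meas: "f \<in> borel_measurable (lebesgue_on \<Omega>)"
    using fH1 by (auto simp: H1_def L2_space_def)
  have g_meas: "g \<in> borel_measurable (lebesgue_on \<Omega>)"
    using g0(1) by (intro borel_measurable_lebesgue_on_AE[OF _ weak_pdiff_unique[OF \<Omega>(1) g0(2) g] \<Omega>_sets])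
      (simp add: L2_space_def)
  \<comment> \<open>The polynomial on a triangle and its derivative represent \<open>f\<close> and \<open>g\<close> in the interior.\<close>
  have "\<forall>S\<in>\<T>. \<exists>p p'. line_derivative i p p' \<and> continuous_on UNIV p \<and> continuous_on UNIV p' \<and>
      (AE x in lebesgue. x \<in> interior S \<longrightarrow> f x = p x \<and> g x = p' x)"
  proof
    fix S assume "S \<in> \<T>"
    then obtain p where p: "poly2_fun r p" "AE x in lebesgue_on S. f x = p x"
      using pw unfolding piecewise_poly_def by blast
    obtain p' where p': "line_derivative i p p'" "continuous_on UNIV p" "continuous_on UNIV p'"
      by (rule poly2_fun_line_derivative[OF p(1)])
    let ?U = "interior S"
    have U: "open ?U" "bounded ?U" "convex ?U" "?U \<in> sets lebesgue"
      using S[OF \<open>S \<in> \<T>\<close>] by (auto intro: bounded_subset[OF compact_imp_bounded interior_subset])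
    have bp: "bounded_pdiff ?U i p p'"
      by (rule bounded_pdiff_C1[OF p' U(1-3)])
    have "S \<in> sets lebesgue"
      using S(1)[OF \<open>S \<in> \<T>\<close>] by (simp add: compact_imp_closed)
    then have "AE x in lebesgue. x \<in> S \<longrightarrow> f x = p x"
      using p(2) by (subst (asm) AE_restrict_space_iff) auto
    then have fp: "AE x in lebesgue. x \<in> ?U \<longrightarrow> f x = p x"
      by (rule eventually_mono) (use interior_subset in blast)
    then have fp': "AE x in lebesgue_on ?U. f x = p x"
      using U(4) by (subst AE_restrict_space_iff) auto
    have "is_weak_pdiff ?U i p g"
    proof (rule is_weak_pdiff_cong_AE[OF is_weak_pdiff_subset[OF g int_sub[OF \<open>S \<in> \<T>\<close>] U(4) \<Omega>_sets] _ fp' U(4)])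
      show "locally_integrable ?U p"
        by (rule integrable_imp_locally_integrable[OF bounded_pdiff_integrable(1)[OF bp U(1,2)] U(4)])
    qed
    then have "AE x in lebesgue_on ?U. g x = p' x"
      by (rule weak_pdiff_unique[OF U(1) _ bounded_pdiff_imp_weak_pdiff[OF bp U(1,2)]])
    then have "AE x in lebesgue. x \<in> ?U \<longrightarrow> g x = p' x"
      using U(4) by (subst (asm) AE_restrict_space_iff) auto
    with fp have "AE x in lebesgue. x \<in> ?U \<longrightarrow> f x = p x \<and> g x = p' x"
      by eventually_elim blast
    then show "\<exists>p p'. line_derivative i p p' \<and> continuous_on UNIV p \<and> continuous_on UNIV p' \<and>
      (AE x in lebesgue. x \<in> ?U \<longrightarrow> f x = p x \<and> g x = p' x)"
      using p' by blast
  qed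
  then obtain P P' where P: "\<And>S. S \<in> \<T> \<Longrightarrow> line_derivative i (P S) (P' S)"
      "\<And>S. S \<in> \<T> \<Longrightarrow> continuous_on UNIV (P S)" "\<And>S. S \<in> \<T> \<Longrightarrow> continuous_on UNIV (P' S)"
    and P_AE: "\<And>S. S \<in> \<T> \<Longrightarrow> AE x in lebesgue. x \<in> interior S \<longrightarrow> f x = P S x \<and> g x = P' S x"
    by (auto dest!: bchoice)
  have eq_AE: "AE x in lebesgue. \<forall>S\<in>\<T>. x \<in> interior S \<longrightarrow> f x = P S x \<and> g x = P' S x"
    using P_AE by (intro AE_finite_allI fin)
  have cover_AE: "AE x in lebesgue. x \<in> \<Omega> \<longrightarrow> (\<exists>S\<in>\<T>. x \<in> interior S)"
  proof (rule AE_negligibleI)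
    show "negligible (\<Union>S\<in>\<T>. frontier S)"
      using fin S(2) by (intro negligible_Union) (auto intro: negligible_convex_frontier)
    fix x assume x: "x \<notin> (\<Union>S\<in>\<T>. frontier S)"
    show "x \<in> \<Omega> \<longrightarrow> (\<exists>S\<in>\<T>. x \<in> interior S)"
    proof
      assume "x \<in> \<Omega>"
      then obtain S' where S': "S' \<in> \<T>" "x \<in> S'"
        using cover closure_subset[of \<Omega>] by blast
      then have "x \<in> interior S'"
        using x closure_subset[of S'] unfolding frontier_def by blast
      then show "\<exists>S\<in>\<T>. x \<in> interior S" using S'(1) by blast
    qed
  qed
  have bd: "\<exists>C\<ge>0. \<forall>S\<in>\<T>. \<forall>x\<in>S. \<bar>Q S x\<bar> \<le> C"
    if "\<And>S. S \<in> \<T> \<Longrightarrow> continuous_on UNIV (Q S)" for Q :: "(real^2) set \<Rightarrow> real^2 \<Rightarrow> real"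
  proof -
    have "bounded (\<Union>S\<in>\<T>. Q S ` S)"
      using S(1) that fin
      by (intro bounded_UN ballI compact_imp_bounded compact_continuous_image) (auto intro: continuous_on_subset)
    then obtain C where "C > 0" "\<forall>y\<in>(\<Union>S\<in>\<T>. Q S ` S). norm y \<le> C"
      unfolding bounded_pos by blast
    then show ?thesis by (intro exI[of _ C]) auto
  qed
  obtain C1 where C1: "C1 \<ge> 0" "\<And>S x. S \<in> \<T> \<Longrightarrow> x \<in> S \<Longrightarrow> \<bar>P S x\<bar> \<le> C1"
    using bd[of P] P(2) by blast
  obtain C2 where C2: "C2 \<ge> 0" "\<And>S x. S \<in> \<T> \<Longrightarrow> x \<in> S \<Longrightarrow> \<bar>P' S x\<bar> \<le> C2"
    using bd[of P'] P(3) by blast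
  have fg_AE: "AE x in lebesgue. x \<in> \<Omega> \<longrightarrow> \<bar>f x\<bar> \<le> C1 \<and> \<bar>g x\<bar> \<le> C2"
    using eq_AE cover_AE
  proof eventually_elim
    case (elim x)
    show ?case
    proof
      assume "x \<in> \<Omega>"
      then obtain S' where S': "S' \<in> \<T>" "x \<in> interior S'" using elim by blast
      then have "x \<in> S'" using interior_subset by blast
      then show "\<bar>f x\<bar> \<le> C1 \<and> \<bar>g x\<bar> \<le> C2"
        using elim(1) S' C1(2)[of S' x] C2(2)[of S' x] by auto
    qed
  qed
  have f_int: "integrable (lebesgue_on \<Omega>) f"
    using fg_AE \<Omega>_sets
    by (intro integrable_bounded[OF \<Omega>(1,2) f_meas, of C1], subst AE_restrict_space_iff)
      (auto elim!: eventually_mono)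
  have g_bound: "AE x in lebesgue_on \<Omega>. \<bar>g x\<bar> \<le> C2"
    using fg_AE \<Omega>_sets by (subst AE_restrict_space_iff) (auto elim!: eventually_mono)
  obtain N where N: "negligible N"
    "\<And>x h. \<lbrakk>h > 0; x \<in> \<Omega> - N; x + h *\<^sub>R ?e \<in> \<Omega> - N\<rbrakk> \<Longrightarrow> \<bar>f (x + h *\<^sub>R ?e) - f x\<bar> \<le> 2 * C2 * h"
    using weak_pdiff_bounded_imp_Lipschitz[OF \<Omega>(1,3) f_int g g_bound C2(1)] by blast
  have N_AE: "AE x in lebesgue. x \<notin> N"
    by (rule AE_negligibleI[OF N(1)]) simp
  have quot_AE: "AE x in lebesgue. x \<in> \<Omega> \<longrightarrow> (\<forall>n. x + (1 / real n) *\<^sub>R ?e \<in> \<Omega> \<longrightarrow> \<bar>diff_quot i f n x\<bar> \<le> 2 * C2)"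
  proof -
    have "AE x in lebesgue. \<forall>n. x + (1 / real n) *\<^sub>R ?e \<notin> N"
      unfolding AE_all_countable by (intro allI AE_translation N_AE)
    with N_AE show ?thesis
    proof eventually_elim
      case (elim x)
      show ?case
      proof (intro impI allI)
        fix n assume x: "x \<in> \<Omega>" and y: "x + (1 / real n) *\<^sub>R ?e \<in> \<Omega>"
        show "\<bar>diff_quot i f n x\<bar> \<le> 2 * C2"
        proof (cases "n = 0")
          case False
          then have "\<bar>f (x + (1 / real n) *\<^sub>R ?e) - f x\<bar> \<le> 2 * C2 * (1 / real n)"
            using elim x y by (intro N(2)) auto
          then show ?thesis
            using False by (simp add: diff_quot_def abs_mult pos_le_divide_eq mult.commute)
        qed (use C2(1) in \<open>simp add: diff_quot_def\<close>)
      qed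
    qed
  qed
  have lim_AE: "AE x in lebesgue. x \<in> \<Omega> \<longrightarrow> (\<lambda>n. diff_quot i f n x) \<longlonglongrightarrow> g x"
  proof -
    have "AE x in lebesgue. \<forall>n. \<forall>S\<in>\<T>. x + (1 / real n) *\<^sub>R ?e \<in> interior S \<longrightarrow>
        f (x + (1 / real n) *\<^sub>R ?e) = P S (x + (1 / real n) *\<^sub>R ?e) \<and> g (x + (1 / real n) *\<^sub>R ?e) = P' S (x + (1 / real n) *\<^sub>R ?e)"
      unfolding AE_all_countable by (intro allI AE_translation eq_AE)
    with eq_AE cover_AE show ?thesis
    proof eventually_elim
      case (elim x)
      show ?case
      proof
        assume "x \<in> \<Omega>"
        then obtain S' where S': "S' \<in> \<T>" "x \<in> interior S'" using elim by blast
        have seq: "(\<lambda>n. x + (1 / real n) *\<^sub>R ?e) \<longlonglongrightarrow> x + 0 *\<^sub>R ?e"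
          by (intro tendsto_intros lim_1_over_n)
        then have "\<forall>\<^sub>F n in sequentially. x + (1 / real n) *\<^sub>R ?e \<in> interior S'"
          using S'(2) by (intro topological_tendstoD[OF seq]) auto
        then have ev: "\<forall>\<^sub>F n in sequentially. diff_quot i (P S') n x = diff_quot i f n x"
        proof (rule eventually_mono)
          fix n assume "x + (1 / real n) *\<^sub>R ?e \<in> interior S'"
          then show "diff_quot i (P S') n x = diff_quot i f n x"
            using elim(1,3) S' by (simp add: diff_quot_def)
        qed
        have "(\<lambda>n. (P S' (x + (1 / real (Suc n)) *\<^sub>R ?e) - P S' x) / (1 / real (Suc n))) \<longlonglongrightarrow> P' S' x"
          using LIMSEQ_Suc[OF lim_1_over_n] by (intro line_derivative_quotient_tendsto[OF P(1)[OF S'(1)]]) simp_all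
        then have "(\<lambda>n. diff_quot i (P S') (Suc n) x) \<longlonglongrightarrow> P' S' x"
          by (simp add: diff_quot_def mult.commute)
        then have "(\<lambda>n. diff_quot i (P S') n x) \<longlonglongrightarrow> P' S' x"
          by (rule LIMSEQ_imp_Suc)
        then have "(\<lambda>n. diff_quot i f n x) \<longlonglongrightarrow> P' S' x"
          using ev by (rule Lim_transform_eventually)
        then show "(\<lambda>n. diff_quot i f n x) \<longlonglongrightarrow> g x"
          using elim(1) S' by simp
      qed
    qed
  qed
  show ?thesis
    unfolding bounded_pdiff_def g_def[symmetric]
  proof (intro conjI exI[of _ "C1 + 2 * C2"] f_meas g_meas)
    show "AE x in lebesgue_on \<Omega>. (\<lambda>n. diff_quot i f n x) \<longlonglongrightarrow> g x"
      using lim_AE \<Omega>_sets by (subst AE_restrict_space_iff) auto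
    have "AE x in lebesgue. x \<in> \<Omega> \<longrightarrow> \<bar>f x\<bar> \<le> C1 + 2 * C2 \<and> \<bar>g x\<bar> \<le> C1 + 2 * C2 \<and>
        (\<forall>n. x + (1 / real n) *\<^sub>R ?e \<in> \<Omega> \<longrightarrow> \<bar>diff_quot i f n x\<bar> \<le> C1 + 2 * C2)"
      using fg_AE quot_AE by eventually_elim (use C1(1) C2(1) in fastforce)
    then show "AE x in lebesgue_on \<Omega>. \<bar>f x\<bar> \<le> C1 + 2 * C2 \<and> \<bar>g x\<bar> \<le> C1 + 2 * C2 \<and>
        (\<forall>n. x + (1 / real n) *\<^sub>R ?e \<in> \<Omega> \<longrightarrow> \<bar>diff_quot i f n x\<bar> \<le> C1 + 2 * C2)"
      using \<Omega>_sets by (subst AE_restrict_space_iff) auto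
  qed
qed

section \<open>Functions with zero boundary values\<close>
text \<open>
  On a bounded domain these functions are integrable, and they form an algebra. So every integrand built
  from finite element functions and their derivatives by sums and products is integrable.
\<close>
definition bounded_measurable :: "(real^2) set \<Rightarrow> (real^2 \<Rightarrow> real) \<Rightarrow> bool" where
  "bounded_measurable \<Omega> f \<longleftrightarrow>
     f \<in> borel_measurable (lebesgue_on \<Omega>) \<and> (\<exists>C. AE x in lebesgue_on \<Omega>. \<bar>f x\<bar> \<le> C)"

lemma bounded_measurable_integrable:
  assumes "open \<Omega>" "bounded \<Omega>" "bounded_measurable \<Omega> f"
  shows "integrable (lebesgue_on \<Omega>) f"
proof -
  obtain C where "AE x in lebesgue_on \<Omega>. \<bar>f x\<bar> \<le> C"
    using assms(3) unfolding bounded_measurable_def by blast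
  then show ?thesis
    using assms(3) by (intro integrable_bounded[OF assms(1,2)]) (auto simp: bounded_measurable_def)
qed

lemma bounded_measurable_const: "bounded_measurable \<Omega> (\<lambda>x. c)"
  by (auto simp: bounded_measurable_def intro!: exI[of _ "\<bar>c\<bar>"])

lemma bounded_measurable_add:
  assumes f: "bounded_measurable \<Omega> f" and g: "bounded_measurable \<Omega> g"
  shows "bounded_measurable \<Omega> (\<lambda>x. f x + g x)"
proof -
  obtain C D where C: "AE x in lebesgue_on \<Omega>. \<bar>f x\<bar> \<le> C" and D: "AE x in lebesgue_on \<Omega>. \<bar>g x\<bar> \<le> D"
    using f g unfolding bounded_measurable_def by blast
  from C D have "AE x in lebesgue_on \<Omega>. \<bar>f x + g x\<bar> \<le> C + D"
    by eventually_elim linarith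
  then show ?thesis
    using f g by (auto simp: bounded_measurable_def intro!: borel_measurable_add)
qed

lemma bounded_measurable_mult:
  assumes f: "bounded_measurable \<Omega> f" and g: "bounded_measurable \<Omega> g"
  shows "bounded_measurable \<Omega> (\<lambda>x. f x * g x)"
proof -
  obtain C D where C: "AE x in lebesgue_on \<Omega>. \<bar>f x\<bar> \<le> C" and D: "AE x in lebesgue_on \<Omega>. \<bar>g x\<bar> \<le> D"
    using f g unfolding bounded_measurable_def by blast
  from C D have "AE x in lebesgue_on \<Omega>. \<bar>f x * g x\<bar> \<le> C * D"
    by eventually_elim (auto simp: abs_mult intro!: mult_mono)
  then show ?thesis
    using f g by (auto simp: bounded_measurable_def intro!: borel_measurable_times)
qed

lemma bounded_measurable_diff:
  assumes f: "bounded_measurable \<Omega> f" and g: "bounded_measurable \<Omega> g"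
  shows "bounded_measurable \<Omega> (\<lambda>x. f x - g x)"
  using bounded_measurable_add[OF f bounded_measurable_mult[OF bounded_measurable_const[of \<Omega> "-1"] g]] by simp

lemma bounded_pdiff_bounded_measurable:
  assumes "bounded_pdiff \<Omega> i f g"
  shows "bounded_measurable \<Omega> f" "bounded_measurable \<Omega> g"
proof -
  obtain C where C: "AE x in lebesgue_on \<Omega>. \<bar>f x\<bar> \<le> C \<and> \<bar>g x\<bar> \<le> C \<and>
      (\<forall>n. x + (1 / real n) *\<^sub>R axis i 1 \<in> \<Omega> \<longrightarrow> \<bar>diff_quot i f n x\<bar> \<le> C)"
    using bounded_pdiff_bound[OF assms] by blast
  have "AE x in lebesgue_on \<Omega>. \<bar>f x\<bar> \<le> C" "AE x in lebesgue_on \<Omega>. \<bar>g x\<bar> \<le> C"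
    by (rule eventually_mono[OF C], simp)+
  then show "bounded_measurable \<Omega> f" "bounded_measurable \<Omega> g"
    using bounded_pdiff_measurable[OF assms] unfolding bounded_measurable_def by blast+
qed

text \<open>
  The Cauchy--Schwarz inequality, in the form of Young's inequality \<open>\<bar>d\<bar> \<le> s + d\<^sup>2/s\<close> integrated
  over \<open>\<Omega>\<close> with \<open>s\<close> close to the norm of \<open>d\<close>.
\<close>
lemma integral_mult_tendsto_0:
  fixes d :: "nat \<Rightarrow> real^2 \<Rightarrow> real"
  assumes \<Omega>: "open \<Omega>" "bounded \<Omega>"
    and F: "bounded_measurable \<Omega> F" and d: "\<And>k. bounded_measurable \<Omega> (d k)"
    and lim: "(\<lambda>k. L2_norm \<Omega> (d k)) \<longlonglongrightarrow> 0"
  shows "(\<lambda>k. integral\<^sup>L (lebesgue_on \<Omega>) (\<lambda>x. F x * d k x)) \<longlonglongrightarrow> 0"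
proof -
  let ?M = "lebesgue_on \<Omega>"
  interpret finite_measure ?M
    using \<Omega> by (intro finite_measure_lebesgue_on lmeasurable_open)
  obtain C0 where C0: "AE x in ?M. \<bar>F x\<bar> \<le> C0"
    using F unfolding bounded_measurable_def by blast
  define C where "C = max C0 0"
  have C: "C \<ge> 0" "AE x in ?M. \<bar>F x\<bar> \<le> C"
    unfolding C_def using C0 by (auto elim!: eventually_mono)
  \<comment> \<open>The term \<open>1 / (k + 1)\<close> keeps \<open>s k\<close> positive when the norm is zero.\<close>
  define s where "s k = L2_norm \<Omega> (d k) + 1 / real (Suc k)" for k
  have L2_nonneg: "L2_norm \<Omega> (d k) \<ge> 0" for k
    unfolding L2_norm_def L2_inner_def by (intro real_sqrt_ge_zero integral_nonneg_AE) simp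
  have s_pos: "s k > 0" for k
    using L2_nonneg[of k] by (simp add: s_def add_nonneg_pos)
  have bound: "\<bar>integral\<^sup>L ?M (\<lambda>x. F x * d k x)\<bar> \<le> C * s k * (measure ?M (space ?M) + 1)" for k
  proof -
    have int_sq: "integrable ?M (\<lambda>x. d k x * d k x)"
      by (intro bounded_measurable_integrable[OF \<Omega>] bounded_measurable_mult d)
    have sq: "integral\<^sup>L ?M (\<lambda>x. d k x * d k x) = (L2_norm \<Omega> (d k))\<^sup>2"
      unfolding L2_norm_def L2_inner_def inner_real_def by (simp add: integral_nonneg_AE)
    have int_Fd: "integrable ?M (\<lambda>x. F x * d k x)"
      by (intro bounded_measurable_integrable[OF \<Omega>] bounded_measurable_mult d F)
    have young: "\<bar>t\<bar> \<le> s k + t * t / s k" for t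
    proof (cases "\<bar>t\<bar> \<le> s k")
      case True
      then show ?thesis using s_pos[of k] by (smt (verit) divide_nonneg_pos zero_le_square)
    next
      case False
      then have "\<bar>t\<bar> * s k \<le> \<bar>t\<bar> * \<bar>t\<bar>" by (intro mult_left_mono) auto
      then have "\<bar>t\<bar> \<le> t * t / s k"
        using s_pos[of k] by (simp add: pos_le_divide_eq)
      then show ?thesis using s_pos[of k] by linarith
    qed
    have "\<bar>integral\<^sup>L ?M (\<lambda>x. F x * d k x)\<bar> \<le> integral\<^sup>L ?M (\<lambda>x. \<bar>F x * d k x\<bar>)"
      using integral_norm_bound[of ?M "\<lambda>x. F x * d k x"] by simp
    also have "\<dots> \<le> integral\<^sup>L ?M (\<lambda>x. C * s k + (C / s k) * (d k x * d k x))"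
    proof (rule integral_mono_AE)
      show "AE x in ?M. \<bar>F x * d k x\<bar> \<le> C * s k + (C / s k) * (d k x * d k x)"
        using C(2)
      proof eventually_elim
        case (elim x)
        have "\<bar>F x * d k x\<bar> \<le> C * (s k + d k x * d k x / s k)"
          unfolding abs_mult using elim C(1) young[of "d k x"] by (intro mult_mono) auto
        then show ?case by (simp add: algebra_simps)
      qed
    qed (use int_Fd int_sq in auto)
    also have "\<dots> = C * s k * measure ?M (space ?M) + (C / s k) * (L2_norm \<Omega> (d k))\<^sup>2"
      using int_sq by (simp add: sq mult.commute)
    also have "\<dots> \<le> C * s k * measure ?M (space ?M) + (C / s k) * (s k)\<^sup>2"
      using C(1) s_pos[of k] L2_nonneg[of k]
      by (intro add_left_mono mult_left_mono power_mono) (auto simp: s_def)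
    also have "\<dots> = C * s k * (measure ?M (space ?M) + 1)"
      using s_pos[of k] by (simp add: power2_eq_square distrib_left)
    finally show ?thesis .
  qed
  have "s \<longlonglongrightarrow> 0"
    using tendsto_add[OF lim LIMSEQ_Suc[OF lim_1_over_n]] by (simp add: s_def[abs_def])
  then have "(\<lambda>k. s k * (C * (measure ?M (space ?M) + 1))) \<longlonglongrightarrow> 0"
    by (rule tendsto_mult_left_zero)
  then have upper: "(\<lambda>k. C * s k * (measure ?M (space ?M) + 1)) \<longlonglongrightarrow> 0"
    by (simp only: mult_ac)
  show ?thesis
  proof (rule Lim_null_comparison[OF _ upper])
    show "\<forall>\<^sub>F k in sequentially. norm (integral\<^sup>L ?M (\<lambda>x. F x * d k x)) \<le> C * s k * (measure ?M (space ?M) + 1)"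
      using bound by (intro always_eventually allI) (simp only: real_norm_def)
  qed
qed

text \<open>
  Functions for which integration by parts against any \<open>F\<close>, whatever its boundary values, produces no
  boundary term.
\<close>
definition zero_boundary :: "(real^2) set \<Rightarrow> (real^2 \<Rightarrow> real) \<Rightarrow> bool" where
  "zero_boundary \<Omega> w \<longleftrightarrow> (\<forall>i. bounded_pdiff \<Omega> i w (weak_pdiff \<Omega> i w)) \<and>
     (\<forall>i F G. bounded_pdiff \<Omega> i F G \<longrightarrow>
        integral\<^sup>L (lebesgue_on \<Omega>) (\<lambda>x. F x * weak_pdiff \<Omega> i w x + G x * w x) = 0)"

lemma test_function_bounded_pdiff:
  assumes \<Omega>: "open \<Omega>" "bounded \<Omega>" "convex \<Omega>" and \<phi>: "\<phi> \<in> test_functions \<Omega>"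
  shows "bounded_pdiff \<Omega> i \<phi> (pdiff i \<phi>)"
  by (intro bounded_pdiff_C1 \<Omega> line_derivative_pdiff test_function_differentiable[OF \<phi>]
      test_function_continuous[OF \<phi>] test_function_continuous[OF pdiff_test_function[OF \<phi>]])

text \<open>
  For a test function in place of \<open>w\<close> the identity defines the weak derivative of \<open>F\<close>, and its left-hand
  side depends continuously on \<open>w\<close> in the \<open>H\<^sup>1\<close> norm.
\<close>
lemma H10_zero_boundary:
  assumes \<Omega>: "open \<Omega>" "bounded \<Omega>" "convex \<Omega>" and w: "w \<in> H10 \<Omega>"
    and bw: "\<And>i. bounded_pdiff \<Omega> i w (weak_pdiff \<Omega> i w)"
  shows "zero_boundary \<Omega> w"
  unfolding zero_boundary_def
proof (intro conjI allI impI bw)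
  fix i F G assume FG: "bounded_pdiff \<Omega> i F G"
  let ?M = "lebesgue_on \<Omega>" and ?w' = "weak_pdiff \<Omega> i w"
  obtain \<phi> where \<phi>: "\<And>k::nat. \<phi> k \<in> test_functions \<Omega>"
    and lim: "(\<lambda>k. L2_norm \<Omega> (\<lambda>x. \<phi> k x - w x)) \<longlonglongrightarrow> 0"
    and lim': "\<And>i. (\<lambda>k. L2_norm \<Omega> (\<lambda>x. pdiff i (\<phi> k) x - weak_pdiff \<Omega> i w x)) \<longlonglongrightarrow> 0"
    using w unfolding H10_def by blast
  note bm_\<phi> = bounded_pdiff_bounded_measurable[OF test_function_bounded_pdiff[OF \<Omega> \<phi>]]
  note bm_w = bounded_pdiff_bounded_measurable[OF bw]
  note bm_F = bounded_pdiff_bounded_measurable[OF FG]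
  note int = bounded_measurable_integrable[OF \<Omega>(1,2)]
  have "(\<lambda>k. integral\<^sup>L ?M (\<lambda>x. F x * (pdiff i (\<phi> k) x - ?w' x))
      + integral\<^sup>L ?M (\<lambda>x. G x * (\<phi> k x - w x))) \<longlonglongrightarrow> 0 + 0"
    by (intro tendsto_add integral_mult_tendsto_0 \<Omega> bm_F bounded_measurable_diff bm_\<phi> bm_w lim lim')
  moreover have "integral\<^sup>L ?M (\<lambda>x. F x * (pdiff i (\<phi> k) x - ?w' x))
      + integral\<^sup>L ?M (\<lambda>x. G x * (\<phi> k x - w x)) = - integral\<^sup>L ?M (\<lambda>x. F x * ?w' x + G x * w x)" for k
  proof -
    have "integral\<^sup>L ?M (\<lambda>x. F x * pdiff i (\<phi> k) x) = - integral\<^sup>L ?M (\<lambda>x. G x * \<phi> k x)"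
      using bounded_pdiff_imp_weak_pdiff[OF FG \<Omega>(1,2)] \<phi>[of k]
      unfolding is_weak_pdiff_def L2_inner_def inner_real_def by blast
    moreover have "integral\<^sup>L ?M (\<lambda>x. F x * (pdiff i (\<phi> k) x - ?w' x))
        = integral\<^sup>L ?M (\<lambda>x. F x * pdiff i (\<phi> k) x) - integral\<^sup>L ?M (\<lambda>x. F x * ?w' x)"
      unfolding right_diff_distrib
      by (intro Bochner_Integration.integral_diff int bounded_measurable_mult bm_F bm_\<phi> bm_w)
    moreover have "integral\<^sup>L ?M (\<lambda>x. G x * (\<phi> k x - w x))
        = integral\<^sup>L ?M (\<lambda>x. G x * \<phi> k x) - integral\<^sup>L ?M (\<lambda>x. G x * w x)"
      unfolding right_diff_distrib
      by (intro Bochner_Integration.integral_diff int bounded_measurable_mult bm_F bm_\<phi> bm_w)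
    moreover have "integral\<^sup>L ?M (\<lambda>x. F x * ?w' x + G x * w x)
        = integral\<^sup>L ?M (\<lambda>x. F x * ?w' x) + integral\<^sup>L ?M (\<lambda>x. G x * w x)"
      by (intro Bochner_Integration.integral_add int bounded_measurable_mult bm_F bm_w)
    ultimately show ?thesis by linarith
  qed
  ultimately have "(\<lambda>k::nat. - integral\<^sup>L ?M (\<lambda>x. F x * ?w' x + G x * w x)) \<longlonglongrightarrow> 0"
    by simp
  then show "integral\<^sup>L ?M (\<lambda>x. F x * ?w' x + G x * w x) = 0"
    by (simp add: LIMSEQ_const_iff)
qed

lemma zero_boundary_lincomb:
  assumes \<Omega>: "open \<Omega>" "bounded \<Omega>" and w: "zero_boundary \<Omega> w" and v: "zero_boundary \<Omega> v"
  shows "zero_boundary \<Omega> (\<lambda>x. a * w x + b * v x)"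
  unfolding zero_boundary_def
proof (intro conjI allI impI)
  fix i
  let ?z = "\<lambda>x. a * w x + b * v x"
  have bw: "bounded_pdiff \<Omega> i w (weak_pdiff \<Omega> i w)" and bv: "bounded_pdiff \<Omega> i v (weak_pdiff \<Omega> i v)"
    using w v unfolding zero_boundary_def by blast+
  have bz: "bounded_pdiff \<Omega> i ?z (\<lambda>x. a * weak_pdiff \<Omega> i w x + b * weak_pdiff \<Omega> i v x)"
    by (intro bounded_pdiff_add bounded_pdiff_cmult bw bv)
  show bz': "bounded_pdiff \<Omega> i ?z (weak_pdiff \<Omega> i ?z)"
    by (rule bounded_pdiff_weak_pdiff[OF bz \<Omega>])
  fix F G assume FG: "bounded_pdiff \<Omega> i F G"
  let ?M = "lebesgue_on \<Omega>"
  note bm = bounded_pdiff_bounded_measurable[OF bw] bounded_pdiff_bounded_measurable[OF bv]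
    bounded_pdiff_bounded_measurable[OF FG] bounded_pdiff_bounded_measurable[OF bz']
  note int = bounded_measurable_integrable[OF \<Omega>]
  have i1: "integrable ?M (\<lambda>x. F x * weak_pdiff \<Omega> i w x + G x * w x)"
    and i2: "integrable ?M (\<lambda>x. F x * weak_pdiff \<Omega> i v x + G x * v x)"
    by (intro int bounded_measurable_add bounded_measurable_mult bm)+
  have "integral\<^sup>L ?M (\<lambda>x. F x * weak_pdiff \<Omega> i ?z x + G x * ?z x)
      = integral\<^sup>L ?M (\<lambda>x. a * (F x * weak_pdiff \<Omega> i w x + G x * w x) + b * (F x * weak_pdiff \<Omega> i v x + G x * v x))"
  proof (rule integral_cong_AE)
    show "AE x in ?M. F x * weak_pdiff \<Omega> i ?z x + G x * ?z x
        = a * (F x * weak_pdiff \<Omega> i w x + G x * w x) + b * (F x * weak_pdiff \<Omega> i v x + G x * v x)"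
      using bounded_pdiff_imp_weak_pdiff_eq[OF bz \<Omega>]
      by (rule eventually_mono) (simp add: algebra_simps)
    show "(\<lambda>x. F x * weak_pdiff \<Omega> i ?z x + G x * ?z x) \<in> borel_measurable ?M"
      by (intro borel_measurable_integrable int bounded_measurable_add bounded_measurable_mult
          bounded_measurable_const bm)
    show "(\<lambda>x. a * (F x * weak_pdiff \<Omega> i w x + G x * w x) + b * (F x * weak_pdiff \<Omega> i v x + G x * v x))
        \<in> borel_measurable ?M"
      by (intro borel_measurable_integrable int bounded_measurable_add bounded_measurable_mult
          bounded_measurable_const bm)
  qed
  also have "\<dots> = a * integral\<^sup>L ?M (\<lambda>x. F x * weak_pdiff \<Omega> i w x + G x * w x)
      + b * integral\<^sup>L ?M (\<lambda>x. F x * weak_pdiff \<Omega> i v x + G x * v x)"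
    using i1 i2 by (subst Bochner_Integration.integral_add) simp_all
  also have "\<dots> = 0"
    using w v FG unfolding zero_boundary_def by simp
  finally show "integral\<^sup>L ?M (\<lambda>x. F x * weak_pdiff \<Omega> i ?z x + G x * ?z x) = 0" .
qed

section \<open>Skew symmetry of the convection terms\<close>
text \<open>
  The divergence theorem for \<open>F w\<close>, whose flux through the boundary is zero.
\<close>
lemma integral_divergence_zero:
  fixes w :: "real^2 \<Rightarrow> real^2"
  assumes \<Omega>: "open \<Omega>" "bounded \<Omega>" and w: "\<And>j. zero_boundary \<Omega> (\<lambda>y. w y $ j)"
    and F: "\<And>i. bounded_pdiff \<Omega> i F (G i)"
  shows "integral\<^sup>L (lebesgue_on \<Omega>)
      (\<lambda>x. F x * (weak_pdiff \<Omega> 1 (\<lambda>y. w y $ 1) x + weak_pdiff \<Omega> 2 (\<lambda>y. w y $ 2) x)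
        + (G 1 x * w x $ 1 + G 2 x * w x $ 2)) = 0"
proof -
  let ?M = "lebesgue_on \<Omega>"
  let ?I = "\<lambda>i x. F x * weak_pdiff \<Omega> i (\<lambda>y. w y $ i) x + G i x * w x $ i"
  have bw: "bounded_pdiff \<Omega> i (\<lambda>y. w y $ j) (weak_pdiff \<Omega> i (\<lambda>y. w y $ j))" for i j
    using w unfolding zero_boundary_def by blast
  have "integrable ?M (?I i)" for i
    by (intro bounded_measurable_integrable[OF \<Omega>] bounded_measurable_add bounded_measurable_mult
        bounded_pdiff_bounded_measurable[OF bw] bounded_pdiff_bounded_measurable[OF F])
  then have "integral\<^sup>L ?M (\<lambda>x. ?I 1 x + ?I 2 x) = integral\<^sup>L ?M (?I 1) + integral\<^sup>L ?M (?I 2)"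
    by (intro Bochner_Integration.integral_add)
  also have "\<dots> = 0"
  proof -
    have "integral\<^sup>L ?M (?I i) = 0" for i
      using w[of i] F[of i] unfolding zero_boundary_def by blast
    then show ?thesis by simp
  qed
  also have "(\<lambda>x. ?I 1 x + ?I 2 x) = (\<lambda>x. F x * (weak_pdiff \<Omega> 1 (\<lambda>y. w y $ 1) x + weak_pdiff \<Omega> 2 (\<lambda>y. w y $ 2) x)
        + (G 1 x * w x $ 1 + G 2 x * w x $ 2))"
    by (intro ext) (simp add: algebra_simps)
  finally show ?thesis .
qed

text \<open>
  The integrand is half the divergence of \<open>S\<^sup>2 w\<close>.
\<close>
lemma density_convection_skew:
  fixes w :: "real^2 \<Rightarrow> real^2"
  assumes \<Omega>: "open \<Omega>" "bounded \<Omega>" and w: "\<And>j. zero_boundary \<Omega> (\<lambda>y. w y $ j)"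
    and S: "\<And>i. bounded_pdiff \<Omega> i S (weak_pdiff \<Omega> i S)"
  shows "L2_inner \<Omega> (\<lambda>x. weak_grad \<Omega> S x \<bullet> w x) S + 1 / 2 * L2_inner \<Omega> (\<lambda>x. weak_div \<Omega> w x * S x) S = 0"
proof -
  let ?M = "lebesgue_on \<Omega>" and ?S' = "\<lambda>i. weak_pdiff \<Omega> i S" and ?W = "\<lambda>i. weak_pdiff \<Omega> i (\<lambda>y. w y $ i)"
  have bw: "bounded_pdiff \<Omega> i (\<lambda>y. w y $ j) (weak_pdiff \<Omega> i (\<lambda>y. w y $ j))" for i j
    using w unfolding zero_boundary_def by blast
  note bm = bounded_pdiff_bounded_measurable[OF bw] bounded_pdiff_bounded_measurable[OF S]
  have i1: "integrable ?M (\<lambda>x. (?S' 1 x * w x $ 1 + ?S' 2 x * w x $ 2) * S x)"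
    and i2: "integrable ?M (\<lambda>x. (?W 1 x + ?W 2 x) * S x * S x)"
    by (intro bounded_measurable_integrable[OF \<Omega>] bounded_measurable_add bounded_measurable_mult bm)+
  have "L2_inner \<Omega> (\<lambda>x. weak_grad \<Omega> S x \<bullet> w x) S + 1 / 2 * L2_inner \<Omega> (\<lambda>x. weak_div \<Omega> w x * S x) S
      = integral\<^sup>L ?M (\<lambda>x. (?S' 1 x * w x $ 1 + ?S' 2 x * w x $ 2) * S x)
        + 1 / 2 * integral\<^sup>L ?M (\<lambda>x. (?W 1 x + ?W 2 x) * S x * S x)"
    by (simp add: L2_inner_def weak_grad_def weak_div_def inner_vec_def UNIV_2)
  also have "\<dots> = integral\<^sup>L ?M (\<lambda>x. (?S' 1 x * w x $ 1 + ?S' 2 x * w x $ 2) * S x + 1 / 2 * ((?W 1 x + ?W 2 x) * S x * S x))"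
    using i1 i2 by (subst Bochner_Integration.integral_add) simp_all
  also have "\<dots> = integral\<^sup>L ?M (\<lambda>x. 1 / 2 * ((S x * S x) * (?W 1 x + ?W 2 x)
      + ((?S' 1 x * S x + S x * ?S' 1 x) * w x $ 1 + (?S' 2 x * S x + S x * ?S' 2 x) * w x $ 2)))"
    by (intro Bochner_Integration.integral_cong refl) (simp add: algebra_simps)
  also have "\<dots> = 1 / 2 * 0"
    unfolding integral_mult_right_zero
    using integral_divergence_zero[OF \<Omega> w bounded_pdiff_mult[OF S S]] by simp
  finally show ?thesis by simp
qed

text \<open>
  The integrand is half the divergence of \<open>R \<bar>U\<bar>\<^sup>2 w\<close>: in the second term the product rule splits
  \<open>\<nabla> \<cdot> (R w)\<close> into \<open>\<nabla>R \<cdot> w + R \<nabla> \<cdot> w\<close>.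
\<close>
lemma momentum_convection_skew:
  fixes w U :: "real^2 \<Rightarrow> real^2"
  assumes \<Omega>: "open \<Omega>" "bounded \<Omega>" and w: "\<And>j. zero_boundary \<Omega> (\<lambda>y. w y $ j)"
    and R: "\<And>i. bounded_pdiff \<Omega> i R (R' i)"
    and U: "\<And>i j. bounded_pdiff \<Omega> i (\<lambda>y. U y $ j) (weak_pdiff \<Omega> i (\<lambda>y. U y $ j))"
  shows "L2_inner \<Omega> (\<lambda>x. R x *\<^sub>R (weak_jac \<Omega> U x *v w x)) U
    + 1 / 2 * L2_inner \<Omega> (\<lambda>x. weak_div \<Omega> (\<lambda>y. R y *\<^sub>R w y) x *\<^sub>R U x) U = 0"
proof -
  let ?M = "lebesgue_on \<Omega>"
  let ?U = "\<lambda>j x. U x $ j" and ?U' = "\<lambda>i j. weak_pdiff \<Omega> i (\<lambda>y. U y $ j)"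
    and ?W = "\<lambda>i. weak_pdiff \<Omega> i (\<lambda>y. w y $ i)"
    and ?V = "\<lambda>i. weak_pdiff \<Omega> i (\<lambda>y. R y * w y $ i)"
  have bw: "bounded_pdiff \<Omega> i (\<lambda>y. w y $ j) (weak_pdiff \<Omega> i (\<lambda>y. w y $ j))" for i j
    using w unfolding zero_boundary_def by blast
  have bRw: "bounded_pdiff \<Omega> i (\<lambda>y. R y * w y $ j) (\<lambda>x. R' i x * w x $ j + R x * weak_pdiff \<Omega> i (\<lambda>y. w y $ j) x)" for i j
    by (rule bounded_pdiff_mult[OF R bw])
  have bV: "bounded_pdiff \<Omega> i (\<lambda>y. R y * w y $ j) (weak_pdiff \<Omega> i (\<lambda>y. R y * w y $ j))" for i j
    by (rule bounded_pdiff_weak_pdiff[OF bRw \<Omega>])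
  have V_eq: "AE x in ?M. ?V i x = R' i x * w x $ i + R x * ?W i x" for i
    by (rule bounded_pdiff_imp_weak_pdiff_eq[OF bRw \<Omega>])
  note bm = bounded_pdiff_bounded_measurable[OF bw] bounded_pdiff_bounded_measurable[OF R]
    bounded_pdiff_bounded_measurable[OF U] bounded_pdiff_bounded_measurable[OF bV]
  note bm_intros = bounded_measurable_add bounded_measurable_mult bounded_measurable_const bm
  \<comment> \<open>\<open>F = R \<bar>U\<bar>\<^sup>2\<close> with its partial derivatives \<open>G i\<close>, in the form in which the product rule
    delivers them.\<close>
  define F where "F x = R x * (?U 1 x * ?U 1 x + ?U 2 x * ?U 2 x)" for x
  define G where "G i x = R' i x * (?U 1 x * ?U 1 x + ?U 2 x * ?U 2 x)
      + R x * ((?U' i 1 x * ?U 1 x + ?U 1 x * ?U' i 1 x) + (?U' i 2 x * ?U 2 x + ?U 2 x * ?U' i 2 x))" for i x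
  have FG: "bounded_pdiff \<Omega> i F (G i)" for i
    unfolding F_def G_def by (intro bounded_pdiff_mult bounded_pdiff_add R U)
  let ?conv = "\<lambda>x. R x * ((?U' 1 1 x * w x $ 1 + ?U' 2 1 x * w x $ 2) * ?U 1 x
      + (?U' 1 2 x * w x $ 1 + ?U' 2 2 x * w x $ 2) * ?U 2 x)"
  let ?div = "\<lambda>x. (?V 1 x + ?V 2 x) * (?U 1 x * ?U 1 x + ?U 2 x * ?U 2 x)"
  have i1: "integrable ?M ?conv" and i2: "integrable ?M ?div"
    by (intro bounded_measurable_integrable[OF \<Omega>] bm_intros)+
  have "L2_inner \<Omega> (\<lambda>x. R x *\<^sub>R (weak_jac \<Omega> U x *v w x)) U = integral\<^sup>L ?M ?conv"
    unfolding L2_inner_def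
    by (intro Bochner_Integration.integral_cong refl)
      (simp add: weak_jac_def weak_grad_def inner_vec_def matrix_vector_mult_def UNIV_2 algebra_simps)
  moreover have "L2_inner \<Omega> (\<lambda>x. weak_div \<Omega> (\<lambda>y. R y *\<^sub>R w y) x *\<^sub>R U x) U = integral\<^sup>L ?M ?div"
    unfolding L2_inner_def
    by (intro Bochner_Integration.integral_cong refl) (simp add: weak_div_def inner_vec_def UNIV_2 distrib_left mult.assoc)
  moreover have "integral\<^sup>L ?M ?conv + 1 / 2 * integral\<^sup>L ?M ?div = integral\<^sup>L ?M (\<lambda>x. ?conv x + 1 / 2 * ?div x)"
    using i1 i2 by (subst Bochner_Integration.integral_add) simp_all
  moreover have "\<dots> = integral\<^sup>L ?M (\<lambda>x. 1 / 2 * (F x * (?W 1 x + ?W 2 x) + (G 1 x * w x $ 1 + G 2 x * w x $ 2)))"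
  proof (rule integral_cong_AE)
    show "(\<lambda>x. ?conv x + 1 / 2 * ?div x) \<in> borel_measurable ?M"
      by (intro borel_measurable_integrable bounded_measurable_integrable[OF \<Omega>] bm_intros)
    show "(\<lambda>x. 1 / 2 * (F x * (?W 1 x + ?W 2 x) + (G 1 x * w x $ 1 + G 2 x * w x $ 2))) \<in> borel_measurable ?M"
      by (intro borel_measurable_integrable bounded_measurable_integrable[OF \<Omega>] bm_intros
          bounded_pdiff_bounded_measurable[OF FG])
    show "AE x in ?M. ?conv x + 1 / 2 * ?div x
        = 1 / 2 * (F x * (?W 1 x + ?W 2 x) + (G 1 x * w x $ 1 + G 2 x * w x $ 2))"
      using V_eq[of 1] V_eq[of 2]
    proof eventually_elim
      case (elim x)
      show ?case unfolding elim F_def G_def by (simp add: field_simps)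
    qed
  qed
  moreover have "\<dots> = 1 / 2 * 0"
    unfolding integral_mult_right_zero using integral_divergence_zero[OF \<Omega> w FG] by simp
  ultimately show ?thesis by simp
qed

section \<open>Energy decay\<close>
text \<open>
  The G-stability of the two-step backward differentiation formula: tested with the newest value, it is
  the increment of a positive quadratic form plus a square.
\<close>
lemma bdf2_identity:
  fixes a b c :: real
  shows "2 * (3 * a - 4 * b + c) * a
    = (a * a + (2 * a - b) * (2 * a - b)) - (b * b + (2 * b - c) * (2 * b - c)) + (a - 2 * b + c) * (a - 2 * b + c)"
  by (simp add: algebra_simps)

theorem proposition2p1:
  fixes \<Omega> :: "(real^2) set" and \<T> :: "(real^2) set set"
    and T \<mu> \<tau> \<kappa> :: real and N :: nat
    and \<sigma> \<rho> p :: "nat \<Rightarrow> real^2 \<Rightarrow> real" and u :: "nat \<Rightarrow> real^2 \<Rightarrow> real^2"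
  assumes domain: "convex_polygonal_domain \<Omega>"
    and mesh: "triangle_mesh \<Omega> \<T>" "\<kappa> > 0" "quasi_uniform \<kappa> \<T>"
    and params: "T > 0" "\<mu> > 0" "N > 0" "\<tau> = T / real N"
    and spaces: "\<And>n. n \<le> N \<Longrightarrow> \<sigma> n \<in> FE_M \<Omega> \<T> 2"
      "\<And>n. n \<le> N \<Longrightarrow> u n \<in> FE_X \<Omega> \<T> 2"
      "\<And>n. n \<le> N \<Longrightarrow> p n \<in> FE_M0 \<Omega> \<T> 1"
    and density: "\<And>n x. n \<le> N \<Longrightarrow> \<rho> n x = (\<sigma> n x)\<^sup>2"
    and scheme_density: "\<And>n \<phi>. 1 \<le> n \<Longrightarrow> n \<le> N - 1 \<Longrightarrow> \<phi> \<in> FE_M \<Omega> \<T> 2 \<Longrightarrow>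
        L2_inner \<Omega> (D_tau \<tau> \<sigma> (n + 1)) \<phi>
        + L2_inner \<Omega> (\<lambda>x. weak_grad \<Omega> (\<sigma> (n + 1)) x \<bullet> extrap u (n + 1) x) \<phi>
        + 1 / 2 * L2_inner \<Omega> (\<lambda>x. weak_div \<Omega> (extrap u (n + 1)) x * \<sigma> (n + 1) x) \<phi> = 0"
    and scheme_momentum: "\<And>n v q. 1 \<le> n \<Longrightarrow> n \<le> N - 1 \<Longrightarrow> v \<in> FE_X \<Omega> \<T> 2 \<Longrightarrow> q \<in> FE_M0 \<Omega> \<T> 1 \<Longrightarrow>
        L2_inner \<Omega> (\<lambda>x. \<sigma> (n + 1) x *\<^sub>R D_tau \<tau> (\<lambda>k y. \<sigma> k y *\<^sub>R u k y) (n + 1) x) v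
        + L2_inner \<Omega> (\<lambda>x. \<rho> (n + 1) x *\<^sub>R (weak_jac \<Omega> (u (n + 1)) x *v extrap u (n + 1) x)) v
        + 1 / 2 * L2_inner \<Omega>
            (\<lambda>x. weak_div \<Omega> (\<lambda>y. \<rho> (n + 1) y *\<^sub>R extrap u (n + 1) y) x *\<^sub>R u (n + 1) x) v
        + B_form \<Omega> \<mu> (u (n + 1), p (n + 1)) (v, q) = 0"
  shows "\<forall>n. 1 \<le> n \<and> n \<le> N - 1 \<longrightarrow> energy \<Omega> \<sigma> u (n + 1) \<le> energy \<Omega> \<sigma> u n"
proof (intro allI impI)
  fix n assume n: "1 \<le> n \<and> n \<le> N - 1"
  then have le: "n + 1 \<le> N" "n \<le> N" "n - 1 \<le> N" by auto
  have \<Omega>: "open \<Omega>" "bounded \<Omega>" "convex \<Omega>"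
    using domain by (auto simp: convex_polygonal_domain_def)
  let ?M = "lebesgue_on \<Omega>"
  have \<tau>: "\<tau> > 0" using params by simp
  have b\<sigma>: "bounded_pdiff \<Omega> i (\<sigma> m) (weak_pdiff \<Omega> i (\<sigma> m))" if "m \<le> N" for i m
    by (rule FE_M_bounded_pdiff[OF domain mesh(1) spaces(1)[OF that]])
  have zu: "zero_boundary \<Omega> (\<lambda>y. u m y $ j)" if "m \<le> N" for m j
  proof (rule H10_zero_boundary[OF \<Omega>])
    show w: "(\<lambda>y. u m y $ j) \<in> H10 \<Omega>"
      using spaces(2)[OF that] by (simp add: FE_X_def)
    have "(\<lambda>y. u m y $ j) \<in> FE_M \<Omega> \<T> 2"
      using spaces(2)[OF that] by (simp add: FE_X_def FE_M_def H10_def)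
    then show "bounded_pdiff \<Omega> i (\<lambda>y. u m y $ j) (weak_pdiff \<Omega> i (\<lambda>y. u m y $ j))" for i
      by (rule FE_M_bounded_pdiff[OF domain mesh(1)])
  qed
  have bu: "bounded_pdiff \<Omega> i (\<lambda>y. u m y $ j) (weak_pdiff \<Omega> i (\<lambda>y. u m y $ j))" if "m \<le> N" for i j m
    using zu[OF that] unfolding zero_boundary_def by blast
  define w where "w = extrap u (n + 1)"
  have zw: "zero_boundary \<Omega> (\<lambda>y. w y $ j)" for j
  proof -
    have "zero_boundary \<Omega> (\<lambda>y. 2 * u n y $ j + (- 1) * u (n - 1) y $ j)"
      by (intro zero_boundary_lincomb \<Omega>(1,2) zu le)
    then show ?thesis by (simp add: w_def extrap_def)
  qed
  let ?a = "\<sigma> (n + 1)" and ?b = "\<sigma> n" and ?c = "\<sigma> (n - 1)"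
  let ?A = "\<lambda>x. ?a x *\<^sub>R u (n + 1) x" and ?B = "\<lambda>x. ?b x *\<^sub>R u n x" and ?C = "\<lambda>x. ?c x *\<^sub>R u (n - 1) x"
  \<comment> \<open>Test the first equation with \<open>\<sigma>\<close> at the new level: the convection terms drop out.\<close>
  have density_step: "L2_inner \<Omega> (D_tau \<tau> \<sigma> (n + 1)) ?a = 0"
    using scheme_density[of n ?a] n spaces(1)[OF le(1)]
      density_convection_skew[OF \<Omega>(1,2) zw b\<sigma>[OF le(1)]] by (simp add: w_def)
  \<comment> \<open>Test the second with the new velocity and pressure: the convection terms drop out again, and so
    do the pressure terms, leaving the nonnegative viscous dissipation.\<close>
  have momentum_step: "L2_inner \<Omega> (\<lambda>x. ?a x *\<^sub>R D_tau \<tau> (\<lambda>k y. \<sigma> k y *\<^sub>R u k y) (n + 1) x) (u (n + 1)) \<le> 0"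
  proof -
    have \<rho>: "\<rho> (n + 1) = (\<lambda>x. ?a x * ?a x)"
      using density[OF le(1)] by (auto simp: power2_eq_square)
    have "B_form \<Omega> \<mu> (u (n + 1), p (n + 1)) (u (n + 1), p (n + 1)) \<ge> 0"
    proof -
      have "0 \<le> L2_inner \<Omega> (\<lambda>x. \<mu> *\<^sub>R weak_jac \<Omega> (u (n + 1)) x) (weak_jac \<Omega> (u (n + 1)))"
        unfolding L2_inner_def using params(2) by (intro integral_nonneg_AE AE_I2) simp
      then show ?thesis
        by (simp add: B_form_def L2_inner_def mult.commute)
    qed
    moreover have "L2_inner \<Omega> (\<lambda>x. \<rho> (n + 1) x *\<^sub>R (weak_jac \<Omega> (u (n + 1)) x *v w x)) (u (n + 1))
        + 1 / 2 * L2_inner \<Omega> (\<lambda>x. weak_div \<Omega> (\<lambda>y. \<rho> (n + 1) y *\<^sub>R w y) x *\<^sub>R u (n + 1) x) (u (n + 1)) = 0"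
      unfolding \<rho>
      by (rule momentum_convection_skew[OF \<Omega>(1,2) zw bounded_pdiff_mult[OF b\<sigma>[OF le(1)] b\<sigma>[OF le(1)]] bu[OF le(1)]])
    ultimately show ?thesis
      using scheme_momentum[of n "u (n + 1)" "p (n + 1)"] n spaces(2,3)[OF le(1)]
      unfolding w_def by linarith
  qed
  note bm = bounded_pdiff_bounded_measurable(1)[OF b\<sigma>] bounded_pdiff_bounded_measurable(1)[OF bu]
  note bm_intros = bounded_measurable_add bounded_measurable_mult bounded_measurable_diff
    bounded_measurable_const bm le
  note int = bounded_measurable_integrable[OF \<Omega>(1,2)]
  \<comment> \<open>The energy is the integral of the same quadratic form \<open>e\<close>, evaluated on \<open>\<sigma>\<close> and on the two
    components of \<open>\<sigma> u\<close>.\<close>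
  define e :: "real \<Rightarrow> real \<Rightarrow> real" where "e s t = s * s + (2 * s - t) * (2 * s - t)" for s t
  have energy_eq: "energy \<Omega> \<sigma> u (Suc m) = integral\<^sup>L ?M (\<lambda>x. e (\<sigma> (Suc m) x) (\<sigma> m x)
      + (e (\<sigma> (Suc m) x * u (Suc m) x $ 1) (\<sigma> m x * u m x $ 1)
       + e (\<sigma> (Suc m) x * u (Suc m) x $ 2) (\<sigma> m x * u m x $ 2)))" if m: "Suc m \<le> N" for m
  proof -
    have norm_sq: "(L2_norm \<Omega> f)\<^sup>2 = integral\<^sup>L ?M (\<lambda>x. f x \<bullet> f x)" for f :: "real^2 \<Rightarrow> 'z::real_inner"
      unfolding L2_norm_def L2_inner_def by (simp add: integral_nonneg_AE)
    have m': "m \<le> N" using m by simp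
    note bi = bm_intros m m'
    have "integrable ?M (\<lambda>x. \<sigma> (Suc m) x \<bullet> \<sigma> (Suc m) x)"
      "integrable ?M (\<lambda>x. (\<sigma> (Suc m) x *\<^sub>R u (Suc m) x) \<bullet> (\<sigma> (Suc m) x *\<^sub>R u (Suc m) x))"
      "integrable ?M (\<lambda>x. (2 * \<sigma> (Suc m) x - \<sigma> m x) \<bullet> (2 * \<sigma> (Suc m) x - \<sigma> m x))"
      "integrable ?M (\<lambda>x. (2 *\<^sub>R (\<sigma> (Suc m) x *\<^sub>R u (Suc m) x) - \<sigma> m x *\<^sub>R u m x)
          \<bullet> (2 *\<^sub>R (\<sigma> (Suc m) x *\<^sub>R u (Suc m) x) - \<sigma> m x *\<^sub>R u m x))"
      unfolding inner_vec_def sum_2 inner_real_def vector_minus_component vector_scaleR_component real_scaleR_def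
      by (intro int bi)+
    then have "energy \<Omega> \<sigma> u (Suc m) = integral\<^sup>L ?M (\<lambda>x. \<sigma> (Suc m) x \<bullet> \<sigma> (Suc m) x
        + (\<sigma> (Suc m) x *\<^sub>R u (Suc m) x) \<bullet> (\<sigma> (Suc m) x *\<^sub>R u (Suc m) x)
        + (2 * \<sigma> (Suc m) x - \<sigma> m x) \<bullet> (2 * \<sigma> (Suc m) x - \<sigma> m x)
        + (2 *\<^sub>R (\<sigma> (Suc m) x *\<^sub>R u (Suc m) x) - \<sigma> m x *\<^sub>R u m x)
          \<bullet> (2 *\<^sub>R (\<sigma> (Suc m) x *\<^sub>R u (Suc m) x) - \<sigma> m x *\<^sub>R u m x))"
      unfolding energy_def norm_sq diff_Suc_1
      by (simp only: Bochner_Integration.integral_add Bochner_Integration.integrable_add)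
    also have "\<dots> = integral\<^sup>L ?M (\<lambda>x. e (\<sigma> (Suc m) x) (\<sigma> m x)
      + (e (\<sigma> (Suc m) x * u (Suc m) x $ 1) (\<sigma> m x * u m x $ 1)
       + e (\<sigma> (Suc m) x * u (Suc m) x $ 2) (\<sigma> m x * u m x $ 2)))"
      unfolding inner_vec_def sum_2 inner_real_def vector_minus_component vector_scaleR_component real_scaleR_def e_def
      by (intro Bochner_Integration.integral_cong refl) linarith
    finally show ?thesis .
  qed
  \<comment> \<open>\<open>?E f\<close> is the sum of \<open>f\<close> over these three scalar sequences.\<close>
  let ?E = "\<lambda>f. \<lambda>x. f (?a x) (?b x) (?c x)
      + (f (?a x * u (n + 1) x $ 1) (?b x * u n x $ 1) (?c x * u (n - 1) x $ 1)
      + f (?a x * u (n + 1) x $ 2) (?b x * u n x $ 2) (?c x * u (n - 1) x $ 2))"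
  let ?bdf = "\<lambda>a b c. (3 * a - 4 * b + c) * (a :: real)"
  have E1: "energy \<Omega> \<sigma> u (n + 1) = integral\<^sup>L ?M (?E (\<lambda>a b c. e a b))"
    using energy_eq[of n] le by simp
  have E0: "energy \<Omega> \<sigma> u n = integral\<^sup>L ?M (?E (\<lambda>a b c. e b c))"
    using energy_eq[of "n - 1"] le n by simp
  have i1: "integrable ?M (?E (\<lambda>a b c. e a b))" and i0: "integrable ?M (?E (\<lambda>a b c. e b c))"
    and i2: "integrable ?M (?E ?bdf)" and i3: "integrable ?M (\<lambda>x. ?bdf (?a x) (?b x) (?c x))"
    and i4: "integrable ?M (\<lambda>x. ?bdf (?a x * u (n + 1) x $ 1) (?b x * u n x $ 1) (?c x * u (n - 1) x $ 1)
      + ?bdf (?a x * u (n + 1) x $ 2) (?b x * u n x $ 2) (?c x * u (n - 1) x $ 2))"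
    unfolding e_def by (intro int bm_intros)+
  have "energy \<Omega> \<sigma> u (n + 1) - energy \<Omega> \<sigma> u n
      = integral\<^sup>L ?M (\<lambda>x. ?E (\<lambda>a b c. e a b) x - ?E (\<lambda>a b c. e b c) x)"
    unfolding E1 E0 by (rule Bochner_Integration.integral_diff[OF i1 i0, symmetric])
  also have "\<dots> \<le> integral\<^sup>L ?M (\<lambda>x. 2 * ?E ?bdf x)"
  proof (rule integral_mono)
    show "integrable ?M (\<lambda>x. ?E (\<lambda>a b c. e a b) x - ?E (\<lambda>a b c. e b c) x)"
      using i1 i0 by (rule Bochner_Integration.integrable_diff)
    show "integrable ?M (\<lambda>x. 2 * ?E ?bdf x)" using i2 by (rule integrable_mult_right)
    have step: "e a b - e b c \<le> 2 * ?bdf a b c" for a b c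
      using bdf2_identity[of a b c] zero_le_square[of "a - 2 * b + c"] unfolding e_def by linarith
    have add3: "x1 + (x2 + x3) - (y1 + (y2 + y3)) \<le> 2 * (z1 + (z2 + z3))"
      if "x1 - y1 \<le> 2 * z1" "x2 - y2 \<le> 2 * z2" "x3 - y3 \<le> 2 * z3" for x1 x2 x3 y1 y2 y3 z1 z2 z3 :: real
      using add_mono[OF that(1) add_mono[OF that(2,3)]] by (simp add: algebra_simps)
    show "?E (\<lambda>a b c. e a b) x - ?E (\<lambda>a b c. e b c) x \<le> 2 * ?E ?bdf x" for x
      by (rule add3[OF step step step])
  qed
  also have "\<dots> = 2 * (integral\<^sup>L ?M (\<lambda>x. ?bdf (?a x) (?b x) (?c x))
      + integral\<^sup>L ?M (\<lambda>x. ?bdf (?a x * u (n + 1) x $ 1) (?b x * u n x $ 1) (?c x * u (n - 1) x $ 1)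
      + ?bdf (?a x * u (n + 1) x $ 2) (?b x * u n x $ 2) (?c x * u (n - 1) x $ 2)))"
    unfolding integral_mult_right_zero by (subst Bochner_Integration.integral_add[OF i3 i4]) simp
  also have "\<dots> \<le> 0"
  proof -
    \<comment> \<open>The factor that turns \<open>?bdf\<close> into the tested difference operator \<open>D_tau\<close>.\<close>
    define k where "k = inverse (2 * \<tau>)"
    have k: "k > 0" using \<tau> by (simp add: k_def)
    have "L2_inner \<Omega> (D_tau \<tau> \<sigma> (n + 1)) ?a = integral\<^sup>L ?M (\<lambda>x. k * ?bdf (?a x) (?b x) (?c x))"
      unfolding L2_inner_def
      by (intro Bochner_Integration.integral_cong refl) (simp add: D_tau_def k_def)
    then have zero: "integral\<^sup>L ?M (\<lambda>x. ?bdf (?a x) (?b x) (?c x)) = 0"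
      using density_step k by simp
    have D: "D_tau \<tau> (\<lambda>k y. \<sigma> k y *\<^sub>R u k y) (n + 1) x = k *\<^sub>R (3 *\<^sub>R ?A x - 4 *\<^sub>R ?B x + ?C x)" for x
      by (simp add: D_tau_def k_def)
    have inner2: "(s *\<^sub>R (k *\<^sub>R z)) \<bullet> v = k * (z $ 1 * (s * v $ 1) + z $ 2 * (s * v $ 2))"
      for s and z v :: "real^2"
      by (simp add: inner_vec_def UNIV_2 algebra_simps)
    have momentum_eq: "L2_inner \<Omega> (\<lambda>x. ?a x *\<^sub>R D_tau \<tau> (\<lambda>k y. \<sigma> k y *\<^sub>R u k y) (n + 1) x) (u (n + 1))
      = k * integral\<^sup>L ?M (\<lambda>x. ?bdf (?a x * u (n + 1) x $ 1) (?b x * u n x $ 1) (?c x * u (n - 1) x $ 1)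
      + ?bdf (?a x * u (n + 1) x $ 2) (?b x * u n x $ 2) (?c x * u (n - 1) x $ 2))"
      unfolding L2_inner_def D inner2 integral_mult_right_zero vector_minus_component
        vector_add_component vector_scaleR_component real_scaleR_def ..
    have cancel: "2 * (0 + t) \<le> 0" if "k * t \<le> 0" for t
      using that k by (simp add: mult_le_0_iff)
    show ?thesis
      unfolding zero by (rule cancel[OF momentum_step[unfolded momentum_eq]])
  qed
  finally show "energy \<Omega> \<sigma> u (n + 1) \<le> energy \<Omega> \<sigma> u n" by simp
qed

end
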